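(* Let $p\in\mathbb N=\{1,2,\dots\}$. The map $B:\mathcal B(\mathcal H_{(p,0)})\to C^\infty_{\mathbb C}(\mathbb CP^2)$, $A\mapsto B_A$, with $$B_A(\mathrm x)=\langle\Phi_p(\mathbf n)\,|\,A\,\Phi_p(\mathbf n)\rangle$$ for $\mathrm x\in\mathbb CP^2$ and $\mathbf n\in S^5$ related by $[\mathbf n]=\mathrm x$, is a mapping-positive symbol correspondence whose operator kernel is the projection $\Pi_{(p,0,0)}$ onto the highest weight space of $(p,0)$ and whose characteristic numbers are $$b_n=(-1)^p\sqrt{\frac{\dim(p,0)}{(n+1)^3}}\;C^{(p,0),\,(0,p),\,n}_{(p,0,0),\,(0,p,p),\,(n,n,n)0}\,.$$
   Context: Representations. In a representation of $SU(3)$ (extended to $\mathfrak{sl}(3,\mathbb C)$) let $T_+,T_-,T_3,U_+,U_-,U_3$ be the images of $E_{12},E_{21},\tfrac12(E_{11}-E_{22}),E_{23},E_{32},\tfrac12(E_{22}-E_{33})$. For $\boldsymbol p=(p,q)\in\mathbb N_0^2$, "the irrep $\boldsymbol p$" is the unitary irrep on $\mathcal H_{\boldsymbol p}$ whose highest weight vector has eigenvalue $p/2$ for $T_3$ and $q/2$ for $U_3$; $\dim(\boldsymbol p)=\frac{(p+1)(q+1)(p+q+2)}2$, $|\boldsymbol p|=p+q$, $\check{\boldsymbol p}=(q,p)$ (the dual irrep). Inner products are linear in the second entry. Gelfand-Tsetlin (GT) basis: an orthonormal basis $\{\boldsymbol e(\boldsymbol p;\boldsymbol\nu,J)\}$ indexed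 by $\boldsymbol\nu=(\nu_1,\nu_2,\nu_3)$ and $J$ where, for integers $0\le r_-\le q\le r_+\le p+q$ and $r_-\le\nu_3\le r_+$: $\nu_1=p+2q-(r_++r_-)$, $\nu_2=r_++r_--\nu_3$, $J=\frac12(r_+-r_-)$. Put $t_{\boldsymbol\nu}=\frac{\nu_1-\nu_2}2$, $u_{\boldsymbol\nu}=\frac{\nu_2-\nu_3}2$ (the eigenvalues of $T_3,U_3$). The basis is determined by a unit highest weight vector $\boldsymbol e(\boldsymbol p;(p+q,q,0),q/2)$ via, with $u=u_{\boldsymbol\nu}$, $U_-\boldsymbol e(\boldsymbol p;\boldsymbol\nu,J)=\sqrt{(J+u)(J-u+1)}\,\boldsymbol e(\boldsymbol p;(\nu_1,\nu_2-1,\nu_3+1),J)$ and $T_-\boldsymbol e(\boldsymbol p;\boldsymbol\nu,J)=\sqrt{\tfrac{(J-u)(p+q+J-u-\nu_3+1)(q+J-u-\nu_3)(u-J+\nu_3+1)}{2J(2J+1)}}\,\boldsymbol e(\boldsymbol p;(\nu_1-1,\nu_2+1,\nu_3),J-\tfrac12)+\sqrt{\tfrac{(J+u+1)(p+q-J-u-\nu_3)(J+u+1+\nu_3-q)(J+u+2+\nu_3)}{2(J+1)(2J+1)}}\,\boldsymbol e(\boldsymbol p;(\nu_1-1,\nu_2+1,\nu_3),J+\tfrac12)$ (terms with zero numerator are $0$). For $\boldsymbol p=(p,0)$ or $(0,p)$, $J$ is determined by $\boldsymbol\nu$ and is omitted. For a GT label $\boldsymbol\nu$ of $\boldsymbol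 p$ put $\check{\boldsymbol\nu}=(|\boldsymbol p|,|\boldsymbol p|,|\boldsymbol p|)-\boldsymbol\nu$. The induced GT basis of $\mathcal H_{\check{\boldsymbol p}}=\mathcal H_{\boldsymbol p}^*$ is $\check{\boldsymbol e}(\check{\boldsymbol p};\check{\boldsymbol\nu},J)=(-1)^{2(t_{\boldsymbol\nu}+u_{\boldsymbol\nu})}\boldsymbol e^*(\boldsymbol p;\boldsymbol\nu,J)$. Coupled basis. For $\boldsymbol p=(p,0)$ or $(0,p)$, $\mathcal B(\mathcal H_{\boldsymbol p})\simeq\mathcal H_{\boldsymbol p}\otimes\mathcal H_{\boldsymbol p}^*=\bigoplus_{n=0}^p(n,n)$ under $A^g=\rho(g)A\rho(g)^{-1}$, with inner product $\operatorname{tr}(A^\dagger B)$; $\{\boldsymbol e(n;\boldsymbol\nu,J)\}$ is the union of GT bases of the summands $(n,n)$, with phases such that all Clebsch-Gordan coefficients $C^{\boldsymbol p,\check{\boldsymbol p},n}_{\boldsymbol\nu_1,\boldsymbol\nu_2,\boldsymbol\nu J}=\langle\boldsymbol e(n;\boldsymbol\nu,J)|\boldsymbol e(\boldsymbol p;\boldsymbol\nu_1)\otimes\check{\boldsymbol e}(\check{\boldsymbol p};\boldsymbol\nu_2)\rangle$ are real and $\boldsymbol e(0;(0,0,0),0)=\mathds 1/\sqrt{\dim\boldsymbol p}$. Symbol correspondences. $\mathbb CP^2\simeq SU(3)/H$, $H=\{\mathrm{diag}(\det(U)^{-1},U):U\in U(2)\}$ the isotropy group of $\mathrm x_0=[1:0:0]$,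 with the invariant integral of total mass $1$. A symbol correspondence $W:\mathcal B(\mathcal H_{\boldsymbol p})\to C^\infty_{\mathbb C}(\mathbb CP^2)$ is an injective linear map with: (1) $W_{A^g}=(W_A)^g$, where $f^g(\mathrm x)=f(g^{-1}\mathrm x)$; (2) $W_{A^\dagger}=\overline{W_A}$; (3) $\int W_A\,d\mathrm x=\operatorname{tr}(A)/\dim(\boldsymbol p)$. Each has a unique operator kernel $K$, fixed by $H$, with $W_A(g\mathrm x_0)=\operatorname{tr}(AK^g)$, and $K=\sum_{n=0}^pc_n\sqrt{(n+1)^3/\dim(\boldsymbol p)}\,\boldsymbol e(n;(n,n,n),0)$ with $c_0=1$, $c_n\in\mathbb R^\times$; the $c_n$ are its characteristic numbers. $W$ is mapping-positive if it maps positive (semidefinite) operators to everywhere $\ge0$ functions and positive-definite operators to everywhere $>0$ functions. The map $\Phi_p$. $\mathcal H_{(p,0)}=\mathrm{Sym}^p(\mathbb C^3)$ with the inner product induced from $(\mathbb C^3)^{\otimes p}$ and $\rho_p$ induced from the defining representation $\rho_1$ of $SU(3)$ on $\mathbb C^3$; it is identified with $\mathbb C^{(p+1)(p+2)/2}$ via the orthonormal basis $\{e_{j,k,l}:j+k+l=p\}$ of normalized symmetrizations of $e_1^{\otimes j}\otimes e_2^{\otimes k}\otimes e_3^{\otimes l}$. $\Phi_p:\mathbb C^3\to\mathbb C^{(p+1)(p+2)/2}$, $\Phi_p(z_1,z_2,z_3)=\sum_{j+k+l=p}\sqrt{\frac{p!}{j!k!l!}}\,z_1^jz_2^kz_3^l\,e_{j,k,l}$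 (i.e. $\Phi_p(w)=w^{\otimes p}$). $S^5\subset\mathbb C^3$ is the unit sphere and $\mathbf n\mapsto[\mathbf n]$ the canonical projection to $\mathbb CP^2$. *)

theory Defs
  imports "HOL-Analysis.Analysis" "HOL-Probability.Probability" "HOL-Combinatorics.Permutations"
begin

section \<open>The group SU(3) and the complex projective plane\<close>

definition cadj :: "complex^3^3 \<Rightarrow> complex^3^3" where
  "cadj g = (\<chi> i j. cnj (g $ j $ i))"

definition SU3 :: "(complex^3^3) set" where
  "SU3 = {g. cadj g ** g = mat 1 \<and> det g = 1}"

typedef CP2 = "{L :: (complex^3) set. vec.subspace L \<and> vec.dim L = 1}"
proof
  show "vec.span {axis 1 1 :: complex^3} \<in> {L. vec.subspace L \<and> vec.dim L = 1}"
    by (auto simp: vec.dim_eq_card_independent axis_eq_0_iff)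
qed

text \<open>The canonical projection; only meaningful for \<open>z \<noteq> 0\<close>.\<close>

definition proj :: "complex^3 \<Rightarrow> CP2" where
  "proj z = Abs_CP2 (vec.span {z})"

definition act :: "complex^3^3 \<Rightarrow> CP2 \<Rightarrow> CP2" where
  "act g x = Abs_CP2 ((*v) g ` Rep_CP2 x)"

definition x0 :: CP2 where
  "x0 = proj (vector [1, 0, 0])"

text \<open>The stabiliser of \<open>x0\<close> in SU(3), which consists of the matrices
  \<open>diag(det(U)^{-1}, U)\<close> with \<open>U\<close> in U(2).\<close>

definition isotropy :: "(complex^3^3) set" where
  "isotropy = {g \<in> SU3. act g x0 = x0}"

text \<open>The quotient topology of \<open>\<complex>\<^sup>3 - {0}\<close>.\<close>

instantiation CP2 :: topological_space
begin

definition open_CP2 :: "CP2 set \<Rightarrow> bool" where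
  "open_CP2 U \<longleftrightarrow> open {z. z \<noteq> 0 \<and> proj z \<in> U}"

instance
proof
  show "open (UNIV :: CP2 set)"
    by (simp add: open_CP2_def open_Collect_neq)
next
  fix S T :: "CP2 set"
  assume "open S" "open T"
  then have "open ({z. z \<noteq> 0 \<and> proj z \<in> S} \<inter> {z. z \<noteq> 0 \<and> proj z \<in> T})"
    by (auto simp: open_CP2_def)
  also have "{z. z \<noteq> 0 \<and> proj z \<in> S} \<inter> {z. z \<noteq> 0 \<and> proj z \<in> T} = {z. z \<noteq> 0 \<and> proj z \<in> S \<inter> T}"
    by auto
  finally show "open (S \<inter> T)"
    by (simp add: open_CP2_def)
next
  fix K :: "CP2 set set"
  assume "\<forall>S\<in>K. open S"
  then have "open (\<Union>S\<in>K. {z. z \<noteq> 0 \<and> proj z \<in> S})"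
    by (auto simp: open_CP2_def)
  also have "(\<Union>S\<in>K. {z. z \<noteq> 0 \<and> proj z \<in> S}) = {z. z \<noteq> 0 \<and> proj z \<in> \<Union>K}"
    by auto
  finally show "open (\<Union>K)"
    by (simp add: open_CP2_def)
qed

end

text \<open>The normalised invariant integral is integration against the (unique) measure with this
  property.\<close>

definition invariant_prob :: "CP2 measure \<Rightarrow> bool" where
  "invariant_prob \<mu> \<longleftrightarrow>
     prob_space \<mu> \<and> sets \<mu> = sets borel \<and> (\<forall>g\<in>SU3. distr \<mu> borel (act g) = \<mu>)"

primrec Ck :: "nat \<Rightarrow> ('a::real_normed_vector \<Rightarrow> 'b::real_normed_vector) \<Rightarrow> bool" where
  "Ck 0 f \<longleftrightarrow> continuous_on UNIV f"
| "Ck (Suc k) f \<longleftrightarrow>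
     (\<forall>x. f differentiable (at x)) \<and> (\<forall>v. Ck k (\<lambda>x. frechet_derivative f (at x) v))"

text \<open>Smoothness over the reals, tested in the three standard affine charts.\<close>

definition smooth_CP2 :: "(CP2 \<Rightarrow> complex) \<Rightarrow> bool" where
  "smooth_CP2 f \<longleftrightarrow> (\<forall>k.
     Ck k (\<lambda>(a::complex, b::complex). f (proj (vector [1, a, b]))) \<and>
     Ck k (\<lambda>(a::complex, b::complex). f (proj (vector [a, 1, b]))) \<and>
     Ck k (\<lambda>(a::complex, b::complex). f (proj (vector [a, b, 1]))))"


section \<open>Coordinate vectors and operators\<close>

text \<open>A finite-dimensional Hilbert space with an orthonormal basis indexed by a finite set \<open>I\<close> is
  represented by the coordinate functions vanishing outside \<open>I\<close>; operators on it are matrices,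
  i.e. coordinate functions for \<open>I \<times> I\<close>, so that \<open>cip (I \<times> I) A B = tr(A\<^sup>\<dagger> B)\<close>.\<close>

type_synonym 'i cvec = "'i \<Rightarrow> complex"

definition cspace :: "'i set \<Rightarrow> 'i cvec set" where
  "cspace I = {v. \<forall>i. i \<notin> I \<longrightarrow> v i = 0}"

definition cip :: "'i set \<Rightarrow> 'i cvec \<Rightarrow> 'i cvec \<Rightarrow> complex" where
  "cip I v w = (\<Sum>i\<in>I. cnj (v i) * w i)"

definition cspan :: "'l set \<Rightarrow> ('l \<Rightarrow> 'i cvec) \<Rightarrow> 'i cvec set" where
  "cspan L f = {v. \<exists>c. v = (\<lambda>i. \<Sum>x\<in>L. c x * f x i)}"

definition orthonormal_basis :: "'i set \<Rightarrow> 'i cvec set \<Rightarrow> 'l set \<Rightarrow> ('l \<Rightarrow> 'i cvec) \<Rightarrow> bool" where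
  "orthonormal_basis I V L f \<longleftrightarrow>
     (\<forall>x\<in>L. \<forall>y\<in>L. cip I (f x) (f y) = (if x = y then 1 else 0)) \<and> cspan L f = V"

definition mv :: "'i set \<Rightarrow> ('i \<times> 'i) cvec \<Rightarrow> 'i cvec \<Rightarrow> 'i cvec" where
  "mv I A v = (\<lambda>a. \<Sum>b\<in>I. A (a, b) * v b)"

definition mm :: "'i set \<Rightarrow> ('i \<times> 'i) cvec \<Rightarrow> ('i \<times> 'i) cvec \<Rightarrow> ('i \<times> 'i) cvec" where
  "mm I A B = (\<lambda>(a, c). \<Sum>b\<in>I. A (a, b) * B (b, c))"

definition op_id :: "'i set \<Rightarrow> ('i \<times> 'i) cvec" where
  "op_id I = (\<lambda>(a, b). if a = b \<and> a \<in> I then 1 else 0)"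

definition op_adj :: "('i \<times> 'i) cvec \<Rightarrow> ('i \<times> 'i) cvec" where
  "op_adj A = (\<lambda>(a, b). cnj (A (b, a)))"

definition op_trace :: "'i set \<Rightarrow> ('i \<times> 'i) cvec \<Rightarrow> complex" where
  "op_trace I A = (\<Sum>a\<in>I. A (a, a))"

definition orth_projection :: "'i set \<Rightarrow> 'i cvec set \<Rightarrow> ('i \<times> 'i) cvec" where
  "orth_projection I S = (THE P. P \<in> cspace (I \<times> I) \<and>
     (\<forall>v\<in>cspace I. mv I P v \<in> S \<and> (\<forall>w\<in>S. cip I w (\<lambda>i. v i - mv I P v i) = 0)))"

definition positive_semidefinite :: "'i set \<Rightarrow> ('i \<times> 'i) cvec \<Rightarrow> bool" where
  "positive_semidefinite I A \<longleftrightarrow> A \<in> cspace (I \<times> I) \<and>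
     (\<forall>v\<in>cspace I. cip I v (mv I A v) \<in> \<real> \<and> Re (cip I v (mv I A v)) \<ge> 0)"

definition positive_definite :: "'i set \<Rightarrow> ('i \<times> 'i) cvec \<Rightarrow> bool" where
  "positive_definite I A \<longleftrightarrow> A \<in> cspace (I \<times> I) \<and>
     (\<forall>v\<in>cspace I. v \<noteq> (\<lambda>_. 0) \<longrightarrow> cip I v (mv I A v) \<in> \<real> \<and> Re (cip I v (mv I A v)) > 0)"

text \<open>The elements of the dual space \<open>H\<^sup>*\<close> are represented by their coordinates in the dual basis,
  so \<open>v\<^sup>* = \<langle>v|_\<rangle>\<close> has the conjugate coordinates and \<open>v \<otimes> \<phi>\<close> is the operator \<open>w \<mapsto> \<phi>(w) v\<close>.\<close>

definition dual_vec :: "'i cvec \<Rightarrow> 'i cvec" where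
  "dual_vec v = (\<lambda>i. cnj (v i))"

definition tensor :: "'i cvec \<Rightarrow> 'i cvec \<Rightarrow> ('i \<times> 'i) cvec" where
  "tensor v \<phi> = (\<lambda>(a, b). v a * \<phi> b)"


section \<open>Representations of the Lie algebra\<close>

text \<open>The power of \<open>(**) X\<close> is iteration: the type class power on \<^typ>\<open>complex^3^3\<close> would be
  componentwise.\<close>

definition mat_exp :: "complex^3^3 \<Rightarrow> complex^3^3" where
  "mat_exp X = (\<Sum>k. (1 / fact k) *\<^sub>R (((**) X ^^ k) (mat 1)))"

type_synonym 'i rep = "complex^3^3 \<Rightarrow> 'i cvec \<Rightarrow> 'i cvec"

definition lie_real :: "'i rep \<Rightarrow> complex^3^3 \<Rightarrow> 'i cvec \<Rightarrow> 'i cvec" where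
  "lie_real R X v = (\<lambda>i. vector_derivative (\<lambda>t. R (mat_exp (t *\<^sub>R X)) v i) (at 0))"

text \<open>The complex linear extension to \<open>\<ss>\<ll>(3, \<complex>)\<close>, using \<open>X = A + \<i>B\<close> with
  \<open>A = (X - X\<^sup>\<dagger>)/2\<close> and \<open>B = -\<i>(X + X\<^sup>\<dagger>)/2\<close> skew-Hermitian.\<close>

definition lie :: "'i rep \<Rightarrow> complex^3^3 \<Rightarrow> 'i cvec \<Rightarrow> 'i cvec" where
  "lie R X v = (\<lambda>i. lie_real R (\<chi> j k. (X $ j $ k - cnj (X $ k $ j)) / 2) v i
                  + \<i> * lie_real R (\<chi> j k. (X $ j $ k + cnj (X $ k $ j)) / (2 * \<i>)) v i)"

definition Emat :: "3 \<Rightarrow> 3 \<Rightarrow> complex^3^3" where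
  "Emat a b = (\<chi> i j. if i = a \<and> j = b then 1 else 0)"

definition T_plus :: "'i rep \<Rightarrow> 'i cvec \<Rightarrow> 'i cvec" where
  "T_plus R = lie R (Emat 1 2)"

definition T_minus :: "'i rep \<Rightarrow> 'i cvec \<Rightarrow> 'i cvec" where
  "T_minus R = lie R (Emat 2 1)"

definition T_3 :: "'i rep \<Rightarrow> 'i cvec \<Rightarrow> 'i cvec" where
  "T_3 R = lie R ((1/2) *\<^sub>R (Emat 1 1 - Emat 2 2))"

definition U_plus :: "'i rep \<Rightarrow> 'i cvec \<Rightarrow> 'i cvec" where
  "U_plus R = lie R (Emat 2 3)"

definition U_minus :: "'i rep \<Rightarrow> 'i cvec \<Rightarrow> 'i cvec" where
  "U_minus R = lie R (Emat 3 2)"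

definition U_3 :: "'i rep \<Rightarrow> 'i cvec \<Rightarrow> 'i cvec" where
  "U_3 R = lie R ((1/2) *\<^sub>R (Emat 2 2 - Emat 3 3))"

definition irrep_dim :: "nat \<Rightarrow> nat \<Rightarrow> real" where
  "irrep_dim p q = (real p + 1) * (real q + 1) * (real p + real q + 2) / 2"

definition highest_weight_space :: "'i rep \<Rightarrow> 'i cvec set \<Rightarrow> nat \<Rightarrow> nat \<Rightarrow> 'i cvec set" where
  "highest_weight_space R V p q = {v \<in> V.
     T_plus R v = (\<lambda>_. 0) \<and> U_plus R v = (\<lambda>_. 0) \<and>
     T_3 R v = (\<lambda>i. of_real (real p / 2) * v i) \<and> U_3 R v = (\<lambda>i. of_real (real q / 2) * v i)}"


section \<open>Gelfand-Tsetlin bases\<close>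

type_synonym weight = "int \<times> int \<times> int"

definition gt_labels :: "nat \<Rightarrow> nat \<Rightarrow> (weight \<times> real) set" where
  "gt_labels p q =
     {((int p + 2 * int q - (rp + rm), rp + rm - \<nu>3, \<nu>3), real_of_int (rp - rm) / 2) | rm rp \<nu>3 :: int.
        0 \<le> rm \<and> rm \<le> int q \<and> int q \<le> rp \<and> rp \<le> int p + int q \<and> rm \<le> \<nu>3 \<and> \<nu>3 \<le> rp}"

text \<open>Both square root coefficients below vanish whenever the basis vector they multiply has no
  label in \<^const>\<open>gt_labels\<close>; for \<open>J = 0\<close> the first one has numerator \<open>0\<close>, and \<open>x / 0 = 0\<close>.\<close>

definition gt_U_coeff :: "weight \<Rightarrow> real \<Rightarrow> real" where
  "gt_U_coeff = (\<lambda>(\<nu>1, \<nu>2, \<nu>3) J. let u = real_of_int (\<nu>2 - \<nu>3) / 2 in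
     sqrt ((J + u) * (J - u + 1)))"

definition gt_T_coeff_down :: "nat \<Rightarrow> nat \<Rightarrow> weight \<Rightarrow> real \<Rightarrow> real" where
  "gt_T_coeff_down p q = (\<lambda>(\<nu>1, \<nu>2, \<nu>3) J. let u = real_of_int (\<nu>2 - \<nu>3) / 2; n3 = real_of_int \<nu>3 in
     sqrt ((J - u) * (real p + real q + J - u - n3 + 1) * (real q + J - u - n3) * (u - J + n3 + 1)
           / (2 * J * (2 * J + 1))))"

definition gt_T_coeff_up :: "nat \<Rightarrow> nat \<Rightarrow> weight \<Rightarrow> real \<Rightarrow> real" where
  "gt_T_coeff_up p q = (\<lambda>(\<nu>1, \<nu>2, \<nu>3) J. let u = real_of_int (\<nu>2 - \<nu>3) / 2; n3 = real_of_int \<nu>3 in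
     sqrt ((J + u + 1) * (real p + real q - J - u - n3) * (J + u + 1 + n3 - real q) * (J + u + 2 + n3)
           / (2 * (J + 1) * (2 * J + 1))))"

text \<open>\<open>e\<close> is a GT basis of the subrepresentation \<open>V\<close> of \<open>R\<close>, which is of type \<open>(p,q)\<close>.\<close>

definition gt_basis ::
  "'i rep \<Rightarrow> 'i set \<Rightarrow> 'i cvec set \<Rightarrow> nat \<Rightarrow> nat \<Rightarrow> (weight \<Rightarrow> real \<Rightarrow> 'i cvec) \<Rightarrow> bool" where
  "gt_basis R I V p q e \<longleftrightarrow>
     (\<forall>g\<in>SU3. \<forall>v\<in>V. R g v \<in> V) \<and>
     orthonormal_basis I V (gt_labels p q) (\<lambda>(\<nu>, J). e \<nu> J) \<and>
     e (int p + int q, int q, 0) (real q / 2) \<in> highest_weight_space R V p q \<and>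
     (\<forall>\<nu>1 \<nu>2 \<nu>3 J. ((\<nu>1, \<nu>2, \<nu>3), J) \<in> gt_labels p q \<longrightarrow>
        U_minus R (e (\<nu>1, \<nu>2, \<nu>3) J) =
          (\<lambda>i. of_real (gt_U_coeff (\<nu>1, \<nu>2, \<nu>3) J) * e (\<nu>1, \<nu>2 - 1, \<nu>3 + 1) J i) \<and>
        T_minus R (e (\<nu>1, \<nu>2, \<nu>3) J) =
          (\<lambda>i. of_real (gt_T_coeff_down p q (\<nu>1, \<nu>2, \<nu>3) J) * e (\<nu>1 - 1, \<nu>2 + 1, \<nu>3) (J - 1/2) i
             + of_real (gt_T_coeff_up p q (\<nu>1, \<nu>2, \<nu>3) J) * e (\<nu>1 - 1, \<nu>2 + 1, \<nu>3) (J + 1/2) i))"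


section \<open>The representation on symmetric tensors\<close>

text \<open>Tensors in \<open>(\<complex>\<^sup>3)\<^sup>\<otimes>\<^sup>p\<close> are coordinate functions on the set of words of length \<open>p\<close>.\<close>

definition words :: "nat \<Rightarrow> 3 list set" where
  "words p = {w. length w = p}"

definition symmetrize :: "nat \<Rightarrow> 3 list cvec \<Rightarrow> 3 list cvec" where
  "symmetrize p x = (\<lambda>w. if w \<in> words p
     then (\<Sum>\<pi> | \<pi> permutes {..<p}. x (permute_list \<pi> w)) / fact p else 0)"

definition tensor_power :: "nat \<Rightarrow> complex^3^3 \<Rightarrow> 3 list cvec \<Rightarrow> 3 list cvec" where
  "tensor_power p g x = (\<lambda>w. if w \<in> words p
     then \<Sum>w'\<in>words p. (\<Prod>i<p. g $ (w ! i) $ (w' ! i)) * x w' else 0)"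

type_synonym midx = "nat \<times> nat \<times> nat"

definition idx :: "nat \<Rightarrow> midx set" where
  "idx p = {(j, k, l). j + k + l = p}"

text \<open>The vector \<open>e_{j,k,l}\<close>: the normalised symmetrisation of
  \<open>e\<^sub>1\<^sup>\<otimes>\<^sup>j \<otimes> e\<^sub>2\<^sup>\<otimes>\<^sup>k \<otimes> e\<^sub>3\<^sup>\<otimes>\<^sup>l\<close>.\<close>

definition sym_vec :: "midx \<Rightarrow> 3 list cvec" where
  "sym_vec = (\<lambda>(j, k, l).
     let p = j + k + l;
         w0 = replicate j 1 @ replicate k 2 @ replicate l 3;
         x = symmetrize p (\<lambda>w. if w = w0 then 1 else 0)
     in (\<lambda>w. x w / of_real (sqrt (\<Sum>w'\<in>words p. (cmod (x w'))\<^sup>2))))"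

text \<open>From here on \<open>H_{(p,0)} = Sym\<^sup>p(\<complex>\<^sup>3)\<close> is \<open>cspace (idx p)\<close>, by means of the basis
  \<open>e_{j,k,l}\<close>. The matrix of \<open>\<rho>_p(g)\<close>, i.e. of the restriction of \<open>g\<^sup>\<otimes>\<^sup>p\<close>:\<close>

definition sym_rep :: "nat \<Rightarrow> complex^3^3 \<Rightarrow> (midx \<times> midx) cvec" where
  "sym_rep p g = (\<lambda>(a, b). if a \<in> idx p \<and> b \<in> idx p
     then cip (words p) (sym_vec a) (tensor_power p g (sym_vec b)) else 0)"

definition vec_rep :: "nat \<Rightarrow> midx rep" where
  "vec_rep p g v = mv (idx p) (sym_rep p g) v"

abbreviation ops :: "nat \<Rightarrow> (midx \<times> midx) cvec set" where
  "ops p \<equiv> cspace (idx p \<times> idx p)"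

text \<open>\<open>A\<^sup>g = \<rho>(g) A \<rho>(g)\<^sup>-\<^sup>1\<close>\<close>

definition op_rep :: "nat \<Rightarrow> (midx \<times> midx) rep" where
  "op_rep p g A = mm (idx p) (sym_rep p g) (mm (idx p) A (sym_rep p (matrix_inv g)))"

definition Phi :: "nat \<Rightarrow> complex^3 \<Rightarrow> midx cvec" where
  "Phi p z = (\<lambda>(j, k, l). if (j, k, l) \<in> idx p
     then of_real (sqrt (fact p / (fact j * fact k * fact l))) * (z $ 1) ^ j * (z $ 2) ^ k * (z $ 3) ^ l
     else 0)"


section \<open>Coupled bases and Clebsch-Gordan coefficients\<close>

text \<open>The induced GT basis of the dual \<open>(0,p)\<close> of \<open>(p,0)\<close>, as a function of the label of the dual;
  note that \<open>2(t + u) = \<nu>1 - \<nu>3\<close>.\<close>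

definition dual_gt :: "nat \<Rightarrow> (weight \<Rightarrow> 'i cvec) \<Rightarrow> weight \<Rightarrow> 'i cvec" where
  "dual_gt p e = (\<lambda>(m1, m2, m3).
     let \<nu>1 = int p - m1; \<nu>2 = int p - m2; \<nu>3 = int p - m3
     in (\<lambda>i. (-1) powi (\<nu>1 - \<nu>3) * dual_vec (e (\<nu>1, \<nu>2, \<nu>3)) i))"

definition clebsch_gordan ::
  "nat \<Rightarrow> (weight \<Rightarrow> midx cvec) \<Rightarrow> (nat \<Rightarrow> weight \<Rightarrow> real \<Rightarrow> (midx \<times> midx) cvec) \<Rightarrow>
   weight \<Rightarrow> weight \<Rightarrow> nat \<Rightarrow> weight \<Rightarrow> real \<Rightarrow> complex" where
  "clebsch_gordan p e E \<nu>1 \<nu>2 n \<nu> J =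
     cip (idx p \<times> idx p) (E n \<nu> J) (tensor (e \<nu>1) (dual_gt p e \<nu>2))"

definition coupled_basis ::
  "nat \<Rightarrow> (weight \<Rightarrow> midx cvec) \<Rightarrow> (nat \<Rightarrow> weight \<Rightarrow> real \<Rightarrow> (midx \<times> midx) cvec) \<Rightarrow> bool" where
  "coupled_basis p e E \<longleftrightarrow>
     orthonormal_basis (idx p \<times> idx p) (ops p)
       {(n, l). n \<le> p \<and> l \<in> gt_labels n n} (\<lambda>(n, \<nu>, J). E n \<nu> J) \<and>
     (\<forall>n\<le>p. gt_basis (op_rep p) (idx p \<times> idx p)
        (cspan (gt_labels n n) (\<lambda>(\<nu>, J). E n \<nu> J)) n n (E n)) \<and>
     (\<forall>n\<le>p. \<forall>(\<nu>, J)\<in>gt_labels n n. \<forall>\<nu>1\<in>fst ` gt_labels p 0. \<forall>\<nu>2\<in>fst ` gt_labels 0 p.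
        clebsch_gordan p e E \<nu>1 \<nu>2 n \<nu> J \<in> \<real>) \<and>
     E 0 (0, 0, 0) 0 = (\<lambda>i. op_id (idx p) i / of_real (sqrt (irrep_dim p 0)))"


section \<open>Symbol correspondences\<close>

type_synonym symbol_map = "(midx \<times> midx) cvec \<Rightarrow> CP2 \<Rightarrow> complex"

definition symbol_correspondence :: "CP2 measure \<Rightarrow> nat \<Rightarrow> symbol_map \<Rightarrow> bool" where
  "symbol_correspondence \<mu> p W \<longleftrightarrow>
     (\<forall>A\<in>ops p. smooth_CP2 (W A)) \<and>
     (\<forall>A\<in>ops p. \<forall>B\<in>ops p. \<forall>x. W (\<lambda>i. A i + B i) x = W A x + W B x) \<and>
     (\<forall>A\<in>ops p. \<forall>c x. W (\<lambda>i. c * A i) x = c * W A x) \<and>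
     inj_on W (ops p) \<and>
     (\<forall>A\<in>ops p. \<forall>g\<in>SU3. \<forall>x. W (op_rep p g A) x = W A (act (matrix_inv g) x)) \<and>
     (\<forall>A\<in>ops p. \<forall>x. W (op_adj A) x = cnj (W A x)) \<and>
     (\<forall>A\<in>ops p. (LINT x|\<mu>. W A x) = op_trace (idx p) A / of_real (irrep_dim p 0))"

definition mapping_positive :: "nat \<Rightarrow> symbol_map \<Rightarrow> bool" where
  "mapping_positive p W \<longleftrightarrow>
     (\<forall>A. positive_semidefinite (idx p) A \<longrightarrow> (\<forall>x. W A x \<in> \<real> \<and> Re (W A x) \<ge> 0)) \<and>
     (\<forall>A. positive_definite (idx p) A \<longrightarrow> (\<forall>x. W A x \<in> \<real> \<and> Re (W A x) > 0))"

definition operator_kernel :: "nat \<Rightarrow> symbol_map \<Rightarrow> (midx \<times> midx) cvec \<Rightarrow> bool" where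
  "operator_kernel p W K \<longleftrightarrow>
     K \<in> ops p \<and> (\<forall>h\<in>isotropy. op_rep p h K = K) \<and>
     (\<forall>A\<in>ops p. \<forall>g\<in>SU3. W A (act g x0) = op_trace (idx p) (mm (idx p) A (op_rep p g K)))"

text \<open>Only the values \<open>c 0, \<dots>, c p\<close> are relevant.\<close>

definition characteristic_numbers ::
  "nat \<Rightarrow> (nat \<Rightarrow> weight \<Rightarrow> real \<Rightarrow> (midx \<times> midx) cvec) \<Rightarrow> symbol_map \<Rightarrow> (nat \<Rightarrow> complex) \<Rightarrow> bool" where
  "characteristic_numbers p E W c \<longleftrightarrow>
     c 0 = 1 \<and> (\<forall>n\<le>p. c n \<in> \<real> \<and> c n \<noteq> 0) \<and>
     operator_kernel p W (\<lambda>i. \<Sum>n\<le>p. c n * of_real (sqrt ((real n + 1) ^ 3 / irrep_dim p 0))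
                                 * E n (int n, int n, int n) 0 i)"

definition berezin :: "nat \<Rightarrow> symbol_map" where
  "berezin p A x = (let n = (SOME n. norm n = 1 \<and> proj n = x)
     in cip (idx p) (Phi p n) (mv (idx p) A (Phi p n)))"

end

theory Submission
  imports Defs "HOL-Combinatorics.Multiset_Permutations"
begin

text \<open>Writing \<open>w\<^sup>\<otimes>\<^sup>p\<close> for the coherent vector \<open>\<Phi>\<^sub>p(w)\<close>, one has \<open>\<rho>\<^sub>p(g) \<Phi>\<^sub>p(w) = \<Phi>\<^sub>p(g w)\<close> and
  \<open>\<langle>\<Phi>\<^sub>p(z)|\<Phi>\<^sub>p(w)\<rangle> = \<langle>z|w\<rangle>\<^sup>p\<close>, which gives equivariance, positivity and the kernel
  \<open>|\<Phi>\<^sub>p(e\<^sub>1)\<rangle>\<langle>\<Phi>\<^sub>p(e\<^sub>1)|\<close>. Injectivity holds because the monomials \<open>cnj(z)\<^sup>a z\<^sup>b\<close> are linearly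
  independent. The lowering operator \<open>U\<^sub>-\<close> annihilates this kernel and its image is orthogonal
  to it, so by the Gelfand-Tsetlin formula for \<open>U\<^sub>-\<close> the kernel is a combination of the
  \<open>U\<close>-singlets \<open>e(n;(n,n,n),0)\<close>; its coefficients are the Clebsch-Gordan coefficients, since the
  kernel is, up to the sign \<open>(-1)\<^sup>p\<close>, the tensor product of the highest weight vector with its
  dual. They do not vanish because \<open>B\<close> is injective.\<close>

section \<open>Symmetric tensors\<close>

text \<open>\<open>Emat 3 2\<close> lies in the complexified Lie algebra of the isotropy group, and
  a GT basis comes with an explicit formula for its action \<open>U_minus\<close>. Its first row and
  first column vanish, so its image under \<open>dsym\<close> has zero row and column at the top
  index \<open>(p, 0, 0)\<close>. The kernel has its only nonzero entry at that index. Hence it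
  commutes with \<open>U_minus\<close>, and every commutator has top entry 0, which is orthogonality
  to the kernel. The obstacle is analytic: \<open>lie\<close> is a derivative along
  \<open>mat_exp\<close>, and for operators also along its inverse, and must first be turned into a
  commutator of explicit matrices. The sign \<open>(-1) ^ p\<close> is the phase attached to the
  induced dual basis at the weight (p,0,0). The highest weight vector is known only up to a phase,
  which cancels against that of its dual. The square root in b_n is the reciprocal of the
  normalisation in the kernel expansion; b_0 = 1 comes from the prescribed \<open>E 0\<close>, and
  reality of b_n from that imposed on the Clebsch-Gordan coefficients.\<close>

definition letter_count :: "3 list \<Rightarrow> midx" where
  "letter_count w = (count_list w 1, count_list w 2, count_list w 3)"

definition mpower :: "complex^3 \<Rightarrow> midx \<Rightarrow> complex" where
  "mpower z = (\<lambda>(j, k, l). (z $ 1) ^ j * (z $ 2) ^ k * (z $ 3) ^ l)"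

definition multinom :: "midx \<Rightarrow> real" where
  "multinom = (\<lambda>(j, k, l). fact (j + k + l) / (fact j * fact k * fact l))"

text \<open>The p-th tensor power of z in word coordinates. Written through letter counts it is
  visibly constant on orbits of the symmetric group, so it expands in \<open>sym_vec\<close>;
  \<open>tpow_alt\<close> recovers the product form.\<close>

definition tpow :: "nat \<Rightarrow> complex^3 \<Rightarrow> 3 list cvec" where
  "tpow p z = (\<lambda>w. if w \<in> words p then mpower z (letter_count w) else 0)"

lemma finite_words [simp]: "finite (words p)"
  using finite_lists_length_eq[of "UNIV :: 3 set" p] by (simp add: words_def)

lemma finite_idx [simp]: "finite (idx p)"
  by (rule finite_subset[of _ "{..p} \<times> {..p} \<times> {..p}"]) (auto simp: idx_def)

lemma multinom_pos: "multinom a > 0"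
  by (cases a) (simp add: multinom_def)

lemma multinom_nonzero [simp]: "multinom a \<noteq> 0"
  using multinom_pos[of a] by simp

lemma words_Suc: "words (Suc p) = (\<lambda>(c, w). c # w) ` (UNIV \<times> words p)"
  by (auto simp: words_def length_Suc_conv image_iff)

text \<open>Distributivity: choosing one summand from each factor is choosing a word. It serves both
  the action of \<open>tensor_power\<close> on pure tensors and the inner product of coherent
  vectors.\<close>

lemma sum_words_prod:
  fixes f :: "nat \<Rightarrow> 3 \<Rightarrow> 'a::comm_semiring_1"
  shows "(\<Sum>w\<in>words p. \<Prod>i<p. f i (w ! i)) = (\<Prod>i<p. \<Sum>c\<in>UNIV. f i c)"
proof (induction p arbitrary: f)
  case 0
  have "words 0 = {[]}" by (auto simp: words_def)
  then show ?case by simp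
next
  case (Suc p)
  have "(\<Sum>w\<in>words (Suc p). \<Prod>i<Suc p. f i (w ! i))
      = (\<Sum>(c, w)\<in>UNIV \<times> words p. f 0 c * (\<Prod>i<p. f (Suc i) (w ! i)))"
    unfolding words_Suc
    by (subst sum.reindex) (auto simp: inj_on_def prod.lessThan_Suc_shift split_beta simp del: prod.lessThan_Suc)
  also have "\<dots> = (\<Sum>c\<in>UNIV. f 0 c) * (\<Prod>i<p. \<Sum>c\<in>UNIV. f (Suc i) c)"
    by (simp add: sum.cartesian_product[symmetric] sum_product Suc.IH[of "\<lambda>i. f (Suc i)", symmetric])
  finally show ?case by (simp add: prod.lessThan_Suc_shift del: prod.lessThan_Suc)
qed

lemma mpower_letter_count: "mpower z (letter_count w) = (\<Prod>i<length w. z $ (w ! i))"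
proof (induction w)
  case (Cons c w)
  have "c = 1 \<or> c = 2 \<or> c = 3" by (rule exhaust_3)
  with Cons show ?case
    by (auto simp: mpower_def letter_count_def prod.lessThan_Suc_shift mult_ac simp del: prod.lessThan_Suc)
qed (simp add: mpower_def letter_count_def)

lemma letter_count_words: "w \<in> words p \<Longrightarrow> letter_count w \<in> idx p"
proof -
  have "count_list w 1 + count_list w 2 + count_list w 3 = length w"
  proof (induction w)
    case (Cons c w)
    then show ?case using exhaust_3[of c] by auto
  qed auto
  then show "w \<in> words p \<Longrightarrow> letter_count w \<in> idx p"
    by (simp add: letter_count_def idx_def words_def)
qed

lemma letter_count_eq_iff_mset: "letter_count w = letter_count w' \<longleftrightarrow> mset w = mset w'"
  unfolding letter_count_def multiset_eq_iff count_mset by (auto simp: forall_3)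

lemma letter_count_std: "letter_count (replicate j 1 @ replicate k 2 @ replicate l 3) = (j, k, l)"
proof -
  have *: "count_list (replicate n x) y = (if x = y then n else 0)" for n and x y :: 3
    by (induction n) auto
  show ?thesis by (simp add: letter_count_def *)
qed

text \<open>Words with a given letter count are the rearrangements of one multiset, so the count of
  \<open>permutations_of_multiset\<close> applies.\<close>

lemma card_letter_count:
  assumes "a \<in> idx p"
  shows "real (card {w \<in> words p. letter_count w = a}) = multinom a"
proof -
  obtain j k l where a: "a = (j, k, l)" by (cases a)
  define w0 where "w0 = replicate j (1::3) @ replicate k 2 @ replicate l 3"
  have len: "length w0 = p" using assms by (simp add: w0_def a idx_def)
  have c0: "letter_count w0 = a" by (simp add: w0_def a letter_count_std)
  have cnt: "count_list w0 1 = j" "count_list w0 2 = k" "count_list w0 3 = l"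
    using c0 by (simp_all add: letter_count_def a)
  have "{w \<in> words p. letter_count w = a} = permutations_of_multiset (mset w0)"
    using len by (auto simp: c0[symmetric] letter_count_eq_iff_mset permutations_of_multiset_def words_def
        dest: mset_eq_length)
  \<comment> \<open>Letters that do not occur contribute the factor \<open>fact 0 = 1\<close>, so
    the product may run over all three letters.\<close>
  moreover have "(\<Prod>x\<in>set_mset (mset w0). fact (count (mset w0) x)) = (\<Prod>x\<in>UNIV. fact (count (mset w0) x) :: nat)"
    by (rule prod.mono_neutral_left) (auto simp: count_mset count_list_0_iff)
  moreover have "\<dots> = fact j * fact k * fact l"
    using cnt unfolding UNIV_3 by (simp add: count_mset)
  ultimately have "card {w \<in> words p. letter_count w = a} * (fact j * fact k * fact l) = fact p"
    using card_permutations_of_multiset_aux[of "mset w0"] len by simp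
  from arg_cong[OF this, of real]
  have "real (card {w \<in> words p. letter_count w = a}) * (fact j * fact k * fact l) = fact p"
    by simp
  then show ?thesis using assms by (simp add: a multinom_def idx_def field_simps)
qed

text \<open>Symmetrising spreads a basis tensor evenly over its orbit; the value is then forced
  because the entries sum to \<open>1\<close>.\<close>

lemma symmetrize_indicator:
  assumes "w0 \<in> words p"
  shows "symmetrize p (\<lambda>w. if w = w0 then 1 else 0) w
    = (if w \<in> words p \<and> letter_count w = letter_count w0 then of_real (1 / multinom (letter_count w0)) else 0)"
proof -
  define N where "N v = (\<Sum>\<pi> | \<pi> permutes {..<p}. if permute_list \<pi> v = w0 then 1 else 0 :: complex)" for v
  have fin: "finite {\<pi>. \<pi> permutes {..<p}}" by (simp add: finite_permutations)
  have N0: "N v = 0" if "v \<in> words p" "letter_count v \<noteq> letter_count w0" for v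
  proof -
    have "permute_list \<pi> v \<noteq> w0" if "\<pi> permutes {..<p}" for \<pi>
      using that \<open>v \<in> words p\<close> \<open>letter_count v \<noteq> letter_count w0\<close> mset_permute_list[of \<pi> v]
      by (auto simp: words_def letter_count_eq_iff_mset)
    then show ?thesis by (simp add: N_def)
  qed
  have Nc: "N v = N w0" if "v \<in> words p" "letter_count v = letter_count w0" for v
  proof -
    from that assms obtain \<sigma> where \<sigma>: "\<sigma> permutes {..<p}" "permute_list \<sigma> w0 = v"
      using mset_eq_permutation[of v w0] by (auto simp: words_def letter_count_eq_iff_mset)
    have "N w0 = (\<Sum>\<pi> | \<pi> permutes {..<p}. if permute_list (\<sigma> \<circ> \<pi>) w0 = w0 then 1 else 0)"
      unfolding N_def by (rule setum_permutations_compose_left[OF \<sigma>(1)])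
    also have "\<dots> = N v"
      unfolding N_def using \<sigma> assms
      by (intro sum.cong refl) (auto simp: permute_list_compose words_def)
    finally show ?thesis by simp
  qed
  \<comment> \<open>Counted the other way round: each permutation sends exactly one word to
    \<open>w0\<close>, so the total is p!.\<close>
  have "(\<Sum>v\<in>words p. N v) = (\<Sum>\<pi> | \<pi> permutes {..<p}. \<Sum>v\<in>words p. if permute_list \<pi> v = w0 then 1 else 0)"
    unfolding N_def by (rule sum.swap)
  also have "\<dots> = (\<Sum>\<pi> | \<pi> permutes {..<p}. 1)"
  proof (intro sum.cong refl)
    fix \<pi> assume "\<pi> \<in> {\<pi>. \<pi> permutes {..<p}}"
    then have \<pi>: "\<pi> permutes {..<p}" "inv \<pi> permutes {..<p}" by (auto intro: permutes_inv)
    have "permute_list \<pi> v = w0 \<longleftrightarrow> v = permute_list (inv \<pi>) w0" if "v \<in> words p" for v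
    proof -
      have "permute_list (inv \<pi>) (permute_list \<pi> v) = v"
        using that \<pi> by (simp add: permute_list_compose[symmetric] words_def permutes_inv_o)
      moreover have "permute_list \<pi> (permute_list (inv \<pi>) w0) = w0"
        using assms \<pi> by (simp add: permute_list_compose[symmetric] words_def permutes_inv_o)
      ultimately show ?thesis by metis
    qed
    then have "(\<Sum>v\<in>words p. if permute_list \<pi> v = w0 then 1 else 0 :: complex)
        = (\<Sum>v\<in>words p. if v = permute_list (inv \<pi>) w0 then 1 else 0)"
      by (intro sum.cong) auto
    also have "\<dots> = 1" using assms by (subst sum.delta[OF finite_words]) (auto simp: words_def)
    finally show "(\<Sum>v\<in>words p. if permute_list \<pi> v = w0 then 1 else 0 :: complex) = 1" .
  qed
  also have "\<dots> = fact p" using card_permutations[of "{..<p}" p] by simp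
  finally have "(\<Sum>v\<in>words p. N v) = fact p" .
  moreover have "(\<Sum>v\<in>words p. N v) = (\<Sum>v\<in>{v \<in> words p. letter_count v = letter_count w0}. N w0)"
    by (rule sum.mono_neutral_cong_right) (auto simp: N0 Nc)
  ultimately have "complex_of_real (real (card {v \<in> words p. letter_count v = letter_count w0})) * N w0 = fact p"
    by simp
  then have "complex_of_real (multinom (letter_count w0)) * N w0 = fact p"
    using card_letter_count[OF letter_count_words[OF assms]] by simp
  then have "N w0 / fact p = of_real (1 / multinom (letter_count w0))"
    using multinom_pos[of "letter_count w0"] by (simp add: field_simps)
  then show ?thesis
    by (auto simp: symmetrize_def N_def[symmetric] N0 Nc)
qed

text \<open>The orbit has \<open>multinom a\<close> words, each with entry
  \<open>1 / multinom a\<close>, so the symmetrised tensor has norm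
  \<open>1 / sqrt (multinom a)\<close>; dividing by it leaves this same number as entry.\<close>

lemma sym_vec_eq:
  assumes "a \<in> idx p"
  shows "sym_vec a w = (if w \<in> words p \<and> letter_count w = a then of_real (1 / sqrt (multinom a)) else 0)"
proof -
  obtain j k l where a: "a = (j, k, l)" by (cases a)
  have p: "j + k + l = p" using assms by (simp add: a idx_def)
  define w0 where "w0 = replicate j (1::3) @ replicate k 2 @ replicate l 3"
  have w0: "w0 \<in> words p" "letter_count w0 = a"
    using p by (auto simp: w0_def a letter_count_std words_def)
  define x where "x = symmetrize p (\<lambda>w. if w = w0 then 1 else 0)"
  have x: "x w = (if w \<in> words p \<and> letter_count w = a then of_real (1 / multinom a) else 0)" for w
    unfolding x_def using symmetrize_indicator[OF w0(1)] by (simp add: w0(2))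
  have "(\<Sum>w'\<in>words p. (cmod (x w'))\<^sup>2) = (\<Sum>w'\<in>{w \<in> words p. letter_count w = a}. (1 / multinom a)\<^sup>2)"
    using multinom_pos[of a]
    by (intro sum.mono_neutral_cong_right) (auto simp: x norm_divide)
  also have "\<dots> = 1 / multinom a"
    using card_letter_count[OF assms] multinom_pos[of a] by (simp add: power2_eq_square)
  finally have n: "sqrt (\<Sum>w'\<in>words p. (cmod (x w'))\<^sup>2) = 1 / sqrt (multinom a)"
    by (simp add: real_sqrt_divide)
  have "sym_vec a w = x w / of_real (1 / sqrt (multinom a))"
    by (simp only: n[symmetric]) (simp add: sym_vec_def a p w0_def x_def Let_def)
  moreover have "1 / multinom a / (1 / sqrt (multinom a)) = 1 / sqrt (multinom a)"
    using multinom_pos[of a] by (simp add: field_simps)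
  ultimately show ?thesis
    by (simp add: x flip: of_real_divide)
qed

lemma sum_words_letter_count:
  assumes "a \<in> idx p"
  shows "(\<Sum>w\<in>words p. if letter_count w = a then (c::complex) else 0) = of_real (multinom a) * c"
proof -
  have "(\<Sum>w\<in>words p. if letter_count w = a then c else 0) = (\<Sum>w\<in>{w \<in> words p. letter_count w = a}. c)"
    by (rule sum.mono_neutral_cong_right) auto
  also have "\<dots> = of_real (real (card {w \<in> words p. letter_count w = a})) * c" by simp
  finally show ?thesis using card_letter_count[OF assms] by simp
qed

lemma sym_vec_orthonormal:
  assumes "a \<in> idx p" "b \<in> idx p"
  shows "cip (words p) (sym_vec a) (sym_vec b) = (if a = b then 1 else 0)"
proof -
  have "cip (words p) (sym_vec a) (sym_vec b)
      = (\<Sum>w\<in>words p. if letter_count w = a then (if a = b then of_real (1 / multinom a) else 0) else 0)"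
    unfolding cip_def
  proof (intro sum.cong refl)
    fix w assume "w \<in> words p"
    moreover have "cnj (of_real (1 / sqrt (multinom a))) * of_real (1 / sqrt (multinom a)) = complex_of_real (1 / multinom a)"
      using multinom_pos[of a] by (simp only: complex_cnj_complex_of_real of_real_mult[symmetric]) simp
    ultimately show "cnj (sym_vec a w) * sym_vec b w
        = (if letter_count w = a then (if a = b then of_real (1 / multinom a) else 0) else 0)"
      unfolding sym_vec_eq[OF assms(1)] sym_vec_eq[OF assms(2)] by (cases "letter_count w = a"; cases "a = b") simp_all
  qed
  also have "\<dots> = (if a = b then 1 else 0)"
    using sum_words_letter_count[OF assms(1)] by (cases "a = b") simp_all
  finally show ?thesis .
qed

section \<open>Coherent vectors as tensor powers\<close>

lemma Phi_eq: "Phi p z a = (if a \<in> idx p then of_real (sqrt (multinom a)) * mpower z a else 0)"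
  by (cases a) (auto simp: Phi_def multinom_def mpower_def idx_def)

text \<open>Only \<open>a = letter_count w\<close> contributes, and there the factor
  \<open>sqrt (multinom a)\<close> of \<open>Phi\<close> cancels the normalisation of
  \<open>sym_vec\<close>. This identifies \<open>Phi p z\<close> with the tensor power of z.\<close>

lemma sum_Phi_sym_vec: "(\<Sum>a\<in>idx p. Phi p z a * sym_vec a w) = tpow p z w"
proof -
  have "(\<Sum>a\<in>idx p. Phi p z a * sym_vec a w) = (\<Sum>a\<in>idx p. if a = letter_count w then tpow p z w else 0)"
    by (intro sum.cong refl) (auto simp: sym_vec_eq Phi_eq tpow_def)
  also have "\<dots> = tpow p z w" by (auto simp: tpow_def letter_count_words)
  finally show ?thesis .
qed

lemma cip_sym_vec_tpow:
  assumes "a \<in> idx p"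
  shows "cip (words p) (sym_vec a) (tpow p z) = Phi p z a"
proof -
  have "cip (words p) (sym_vec a) (tpow p z)
      = (\<Sum>w\<in>words p. if letter_count w = a then of_real (1 / sqrt (multinom a)) * mpower z a else 0)"
    unfolding cip_def using assms by (intro sum.cong refl) (auto simp: sym_vec_eq tpow_def)
  also have "\<dots> = of_real (multinom a / sqrt (multinom a)) * mpower z a"
    using sum_words_letter_count[OF assms] by simp
  also have "multinom a / sqrt (multinom a) = sqrt (multinom a)"
    using multinom_pos[of a] by (simp add: real_div_sqrt)
  finally show ?thesis using assms by (simp add: Phi_eq)
qed

lemma tpow_alt: "w \<in> words p \<Longrightarrow> tpow p z w = (\<Prod>i<p. z $ (w ! i))"
  by (auto simp: tpow_def mpower_letter_count words_def)

lemma tensor_power_tpow: "tensor_power p g (tpow p z) = tpow p (g *v z)"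
proof
  fix w
  show "tensor_power p g (tpow p z) w = tpow p (g *v z) w"
  proof (cases "w \<in> words p")
    case True
    have "tensor_power p g (tpow p z) w = (\<Sum>w'\<in>words p. \<Prod>i<p. g $ (w ! i) $ (w' ! i) * z $ (w' ! i))"
      using True by (simp add: tensor_power_def tpow_alt prod.distrib)
    also have "\<dots> = (\<Prod>i<p. \<Sum>c\<in>UNIV. g $ (w ! i) $ c * z $ c)"
      by (rule sum_words_prod)
    finally show ?thesis using True by (simp add: tpow_alt matrix_vector_mult_def)
  qed (simp add: tensor_power_def tpow_def)
qed

lemma tensor_power_sum:
  "(\<Sum>b\<in>S. tensor_power p g (f b) w * c b) = tensor_power p g (\<lambda>w'. \<Sum>b\<in>S. f b w' * c b) w"
proof (cases "w \<in> words p")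
  case True
  have "(\<Sum>b\<in>S. tensor_power p g (f b) w * c b)
    = (\<Sum>b\<in>S. \<Sum>w'\<in>words p. (\<Prod>i<p. g $ (w ! i) $ (w' ! i)) * (f b w' * c b))"
    using True by (simp add: tensor_power_def sum_distrib_right mult.assoc)
  also have "\<dots> = (\<Sum>w'\<in>words p. \<Sum>b\<in>S. (\<Prod>i<p. g $ (w ! i) $ (w' ! i)) * (f b w' * c b))"
    by (rule sum.swap)
  finally show ?thesis using True by (simp add: tensor_power_def sum_distrib_left)
qed (simp add: tensor_power_def)

text \<open>\<open>sym_rep\<close> only records inner products with the symmetric basis. Nothing is
  lost by it here, because \<open>tensor_power\<close> maps \<open>tpow p z\<close> to another
  \<open>tpow\<close>, which lies in the span of that basis.\<close>

lemma sym_rep_Phi: "mv (idx p) (sym_rep p g) (Phi p z) = Phi p (g *v z)"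
proof
  fix a
  show "mv (idx p) (sym_rep p g) (Phi p z) a = Phi p (g *v z) a"
  proof (cases "a \<in> idx p")
    case True
    have "mv (idx p) (sym_rep p g) (Phi p z) a
      = (\<Sum>b\<in>idx p. \<Sum>w\<in>words p. cnj (sym_vec a w) * (tensor_power p g (sym_vec b) w * Phi p z b))"
      using True by (simp add: mv_def sym_rep_def cip_def sum_distrib_right mult.assoc)
    also have "\<dots> = (\<Sum>w\<in>words p. \<Sum>b\<in>idx p. cnj (sym_vec a w) * (tensor_power p g (sym_vec b) w * Phi p z b))"
      by (rule sum.swap)
    also have "\<dots> = cip (words p) (sym_vec a) (tensor_power p g (\<lambda>w'. \<Sum>b\<in>idx p. sym_vec b w' * Phi p z b))"
      by (simp add: cip_def sum_distrib_left[symmetric] tensor_power_sum)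
    also have "\<dots> = Phi p (g *v z) a"
      using True sum_Phi_sym_vec[of p z] by (simp add: mult.commute tensor_power_tpow cip_sym_vec_tpow)
    finally show ?thesis .
  qed (simp add: mv_def sym_rep_def Phi_eq)
qed

text \<open>Conjugating the double sum over words exchanges the two indices. For unitary g this
  turns the inverse inside \<open>op_rep\<close> into an adjoint.\<close>

lemma sym_rep_cadj: "sym_rep p (cadj g) = op_adj (sym_rep p g)"
proof
  fix ab :: "midx \<times> midx"
  obtain a b where ab: "ab = (a, b)" by (cases ab)
  have "cip (words p) (sym_vec a) (tensor_power p (cadj g) (sym_vec b))
    = (\<Sum>w\<in>words p. \<Sum>w'\<in>words p. cnj (sym_vec a w) * (\<Prod>i<p. cadj g $ (w ! i) $ (w' ! i)) * sym_vec b w')"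
    by (simp add: cip_def tensor_power_def sum_distrib_left mult_ac)
  also have "\<dots> = (\<Sum>w'\<in>words p. \<Sum>w\<in>words p. cnj (sym_vec a w) * (\<Prod>i<p. cadj g $ (w ! i) $ (w' ! i)) * sym_vec b w')"
    by (rule sum.swap)
  also have "\<dots> = cnj (cip (words p) (sym_vec b) (tensor_power p g (sym_vec a)))"
    by (simp add: cip_def tensor_power_def sum_distrib_left mult_ac cadj_def)
  finally show "sym_rep p (cadj g) ab = op_adj (sym_rep p g) ab"
    by (simp add: ab sym_rep_def op_adj_def)
qed

text \<open>In word coordinates the inner product is a sum over words of letterwise products, and
  this factorises.\<close>

lemma cip_Phi: "cip (idx p) (Phi p z) (Phi p w) = (\<Sum>i\<in>UNIV. cnj (z $ i) * w $ i) ^ p"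
proof -
  have "cip (idx p) (Phi p z) (Phi p w)
    = (\<Sum>a\<in>idx p. \<Sum>v\<in>words p. cnj (Phi p z a) * (cnj (sym_vec a v) * tpow p w v))"
    unfolding cip_def by (intro sum.cong refl) (simp add: cip_sym_vec_tpow[symmetric] cip_def[of "words p"] sum_distrib_left)
  also have "\<dots> = (\<Sum>v\<in>words p. \<Sum>a\<in>idx p. cnj (Phi p z a) * (cnj (sym_vec a v) * tpow p w v))"
    by (rule sum.swap)
  also have "\<dots> = (\<Sum>v\<in>words p. cnj (\<Sum>a\<in>idx p. Phi p z a * sym_vec a v) * tpow p w v)"
    by (simp add: sum_distrib_right sum_distrib_left mult_ac)
  also have "\<dots> = (\<Sum>v\<in>words p. \<Prod>i<p. cnj (z $ (v ! i)) * w $ (v ! i))"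
    unfolding sum_Phi_sym_vec by (intro sum.cong refl) (simp add: tpow_alt prod.distrib)
  also have "\<dots> = (\<Prod>i<p. \<Sum>c\<in>UNIV. cnj (z $ c) * w $ c)"
    by (rule sum_words_prod)
  finally show ?thesis by simp
qed

section \<open>Linear independence of mixed monomials\<close>

text \<open>A polynomial with infinitely many roots is zero. The exponents \<open>m t\<close> may
  repeat, so what vanishes is the sum of \<open>a\<close> over each fibre of
  \<open>m\<close>.\<close>

lemma sum_power_coeff_zero:
  fixes a :: "'t \<Rightarrow> complex"
  assumes "finite T" "infinite S" "\<And>s. s \<in> S \<Longrightarrow> (\<Sum>t\<in>T. a t * s ^ m t) = 0"
  shows "(\<Sum>t | t \<in> T \<and> m t = n. a t) = 0"
proof -
  define q where "q = (\<Sum>t\<in>T. Polynomial.monom (a t) (m t))"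
  have "poly q s = 0" if "s \<in> S" for s
    using assms(3)[OF that] by (simp add: q_def poly_sum poly_monom)
  then have "S \<subseteq> {s. poly q s = 0}" by auto
  then have "q = 0"
    using \<open>infinite S\<close> poly_roots_finite[of q] finite_subset by blast
  then have "(\<Sum>t\<in>T. if m t = n then a t else 0) = 0"
    using coeff_sum[of "\<lambda>t. Polynomial.monom (a t) (m t)" T n] by (simp add: q_def)
  then show ?thesis
    using assms(1) by (simp add: sum.If_cases Collect_conj_eq Int_commute)
qed

lemma infinite_unit_circle: "infinite {u. cmod u = 1}"
proof
  assume "finite {u. cmod u = 1}"
  then have "finite (Re ` {u. cmod u = 1})" by simp
  moreover have "{0..1} \<subseteq> Re ` {u. cmod u = 1}"
  proof
    fix x :: real assume x: "x \<in> {0..1}"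
    then have "x\<^sup>2 \<le> 1" by (simp add: power_le_one)
    then have "cmod (Complex x (sqrt (1 - x\<^sup>2))) = 1" by (simp add: cmod_def)
    then show "x \<in> Re ` {u. cmod u = 1}" by (intro image_eqI[of _ _ "Complex x (sqrt (1 - x\<^sup>2))"]) auto
  qed
  ultimately have "finite {0..1::real}" by (rule finite_subset[rotated])
  then show False by (simp add: infinite_Icc)
qed

text \<open>Polar coordinates \<open>z = r u\<close> separate \<open>j + k\<close> (degree in \<open>r\<close>) from \<open>k - j\<close> (degree in \<open>u\<close>).\<close>

lemma mixed_coeff_zero:
  fixes c :: "'t \<Rightarrow> complex"
  assumes fin: "finite T" and zero: "\<And>z. (\<Sum>t\<in>T. c t * (cnj z ^ j t * z ^ k t)) = 0"
  shows "(\<Sum>t | t \<in> T \<and> j t = J \<and> k t = K. c t) = 0"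
proof -
  have *: "(\<Sum>t | t \<in> T \<and> j t + k t = J + K. c t * (cnj u ^ j t * u ^ k t)) = 0" for u
  proof (rule sum_power_coeff_zero[OF fin, where S = "range complex_of_real" and m = "\<lambda>t. j t + k t"])
    show "infinite (range complex_of_real)"
      by (metis finite_imageD infinite_UNIV_char_0 inj_of_real)
    show "(\<Sum>t\<in>T. c t * (cnj u ^ j t * u ^ k t) * s ^ (j t + k t)) = 0"
      if "s \<in> range complex_of_real" for s
    proof -
      have "cnj s = s" using that by auto
      then show ?thesis
        using zero[of "s * u"] by (simp add: power_mult_distrib power_add mult_ac)
    qed
  qed
  \<comment> \<open>On the unit circle \<open>cnj u\<close> is the inverse of \<open>u\<close>.
    Multiplying by \<open>u ^ (J + K)\<close> turns \<open>cnj u ^ j t * u ^ k t\<close> into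
    \<open>u ^ (2 * k t)\<close>, a genuine polynomial term; hence the doubled exponents.\<close>
  have "(\<Sum>t | t \<in> {t \<in> T. j t + k t = J + K} \<and> 2 * k t = 2 * K. c t) = 0"
  proof (rule sum_power_coeff_zero[OF _ infinite_unit_circle, where m = "\<lambda>t. 2 * k t"])
    fix u assume "u \<in> {u. cmod u = 1}"
    then have u: "cnj u * u = 1"
      using complex_norm_square[of u] by (simp add: mult.commute)
    have "cnj u ^ j t * u ^ k t * u ^ (J + K) = u ^ (2 * k t)" if "j t + k t = J + K" for t
    proof -
      have "cnj u ^ j t * u ^ k t * u ^ (J + K) = (cnj u * u) ^ j t * (u ^ k t * u ^ k t)"
        unfolding that[symmetric] by (simp add: power_add power_mult_distrib mult_ac)
      then show ?thesis by (simp add: u mult_2 power_add)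
    qed
    then have "(\<Sum>t | t \<in> T \<and> j t + k t = J + K. c t * u ^ (2 * k t))
        = (\<Sum>t | t \<in> T \<and> j t + k t = J + K. c t * (cnj u ^ j t * u ^ k t)) * u ^ (J + K)"
      unfolding sum_distrib_right by (intro sum.cong refl) (simp add: mult.assoc)
    then show "(\<Sum>t | t \<in> T \<and> j t + k t = J + K. c t * u ^ (2 * k t)) = 0"
      by (simp add: *)
  qed (use fin in auto)
  moreover have "{t. t \<in> {t \<in> T. j t + k t = J + K} \<and> 2 * k t = 2 * K} = {t. t \<in> T \<and> j t = J \<and> k t = K}"
    by auto
  ultimately show ?thesis by simp
qed

text \<open>The homogeneous extension of the symbol from unit vectors to all of
  \<open>complex^3\<close>, where it is a polynomial in the coordinates and their
  conjugates.\<close>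

definition qform :: "nat \<Rightarrow> (midx \<times> midx) cvec \<Rightarrow> complex^3 \<Rightarrow> complex" where
  "qform p A z = cip (idx p) (Phi p z) (mv (idx p) A (Phi p z))"

lemma qform_sum:
  "qform p A z = (\<Sum>(a, b)\<in>idx p \<times> idx p. A (a, b) * (cnj (Phi p z a) * Phi p z b))"
  by (simp add: qform_def cip_def mv_def sum_distrib_left sum.cartesian_product mult_ac)

text \<open>Setting \<open>z\<^sub>1 = 1\<close> loses nothing by homogeneity.\<close>

lemma qform_zero_imp:
  assumes zero: "\<And>z. qform p A z = 0" and a: "a \<in> idx p" and b: "b \<in> idx p"
  shows "A (a, b) = 0"
proof -
  define I where "I = idx p \<times> idx p"
  define c where "c = (\<lambda>(a, b). A (a, b) * of_real (sqrt (multinom a) * sqrt (multinom b)))"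
  define j1 k1 j2 k2 :: "midx \<times> midx \<Rightarrow> nat"
    where "j1 = (\<lambda>(a, b). fst (snd a))" and "k1 = (\<lambda>(a, b). fst (snd b))"
      and "j2 = (\<lambda>(a, b). snd (snd a))" and "k2 = (\<lambda>(a, b). snd (snd b))"
  have fin: "finite I" by (simp add: I_def)
  have expand: "(\<Sum>t\<in>I. c t * (cnj y ^ j2 t * y ^ k2 t) * (cnj x ^ j1 t * x ^ k1 t)) = 0" for x y
  proof -
    have "(\<Sum>t\<in>I. c t * (cnj y ^ j2 t * y ^ k2 t) * (cnj x ^ j1 t * x ^ k1 t)) = qform p A (vector [1, x, y])"
      unfolding qform_sum I_def c_def j1_def k1_def j2_def k2_def
      by (intro sum.cong refl) (auto simp: Phi_eq mpower_def)
    then show ?thesis using zero by simp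
  qed
  \<comment> \<open>The variables are separated one at a time: \<open>x\<close> with
    \<open>y\<close> fixed, and then \<open>y\<close>.\<close>
  have "(\<Sum>t | t \<in> I \<and> j1 t = j1 (a, b) \<and> k1 t = k1 (a, b). c t * (cnj y ^ j2 t * y ^ k2 t)) = 0" for y
    by (rule mixed_coeff_zero[OF fin]) (rule expand)
  then have "(\<Sum>t | t \<in> {t. t \<in> I \<and> j1 t = j1 (a, b) \<and> k1 t = k1 (a, b)} \<and> j2 t = j2 (a, b) \<and> k2 t = k2 (a, b). c t) = 0"
    by (rule mixed_coeff_zero[rotated]) (use fin in auto)
  \<comment> \<open>The entries of an index add up to p, so the last two determine the first and the
    fibre is a single pair.\<close>
  moreover have "{t. t \<in> {t. t \<in> I \<and> j1 t = j1 (a, b) \<and> k1 t = k1 (a, b)} \<and> j2 t = j2 (a, b) \<and> k2 t = k2 (a, b)} = {(a, b)}"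
    using a b by (auto simp: I_def j1_def k1_def j2_def k2_def idx_def)
  ultimately have "c (a, b) = 0" by simp
  then show ?thesis using multinom_pos[of a] multinom_pos[of b] by (simp add: c_def)
qed

section \<open>The action of SU(3) on the projective plane\<close>

definition hdot :: "complex^3 \<Rightarrow> complex^3 \<Rightarrow> complex" where
  "hdot z w = (\<Sum>i\<in>UNIV. cnj (z $ i) * w $ i)"

lemma hdot_self: "hdot z z = of_real ((norm z)\<^sup>2)"
proof -
  have "hdot z z = of_real (\<Sum>i\<in>UNIV. (norm (z $ i))\<^sup>2)"
    by (simp add: hdot_def complex_norm_square mult.commute del: of_real_power)
  also have "(\<Sum>i\<in>UNIV. (norm (z $ i))\<^sup>2) = (norm z)\<^sup>2"
    by (simp add: norm_vec_def L2_set_def sum_nonneg)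
  finally show ?thesis .
qed

lemma hdot_matrix: "hdot (g *v z) w = hdot z (cadj g *v w)"
proof -
  have "hdot (g *v z) w = (\<Sum>i\<in>UNIV. \<Sum>j\<in>UNIV. cnj (z $ j) * (cnj (g $ i $ j) * w $ i))"
    by (simp add: hdot_def matrix_vector_mult_def sum_distrib_right sum_distrib_left mult_ac)
  also have "\<dots> = (\<Sum>j\<in>UNIV. \<Sum>i\<in>UNIV. cnj (z $ j) * (cnj (g $ i $ j) * w $ i))"
    by (rule sum.swap)
  finally show ?thesis by (simp add: hdot_def matrix_vector_mult_def cadj_def sum_distrib_left)
qed

lemma matrix_inv_unique:
  fixes A B :: "complex^3^3"
  assumes "A ** B = mat 1"
  shows "matrix_inv A = B"
proof -
  have BA: "B ** A = mat 1" using assms by (simp add: matrix_left_right_inverse)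
  then have "\<exists>A'. A ** A' = mat 1 \<and> A' ** A = mat 1" using assms by blast
  then have "matrix_inv A ** A = mat 1"
    unfolding matrix_inv_def by (rule someI2_ex) auto
  then have "matrix_inv A ** A ** B = B" by simp
  then show ?thesis by (simp add: assms flip: matrix_mul_assoc)
qed

lemma cadj_cadj [simp]: "cadj (cadj g) = g"
  by (simp add: cadj_def vec_eq_iff)

lemma SU3_D:
  assumes "g \<in> SU3"
  shows "cadj g ** g = mat 1" "g ** cadj g = mat 1" "det g = 1" "matrix_inv g = cadj g" "cadj g \<in> SU3"
proof -
  show 1: "cadj g ** g = mat 1" and d: "det g = 1" using assms by (auto simp: SU3_def)
  then show 2: "g ** cadj g = mat 1" by (simp add: matrix_left_right_inverse)
  then show "matrix_inv g = cadj g" by (rule matrix_inv_unique)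
  have "det (cadj g) = 1"
    using arg_cong[OF 1, of det] by (simp add: det_mul d)
  then show "cadj g \<in> SU3" using 2 by (simp add: SU3_def)
qed

lemma SU3_hdot: "g \<in> SU3 \<Longrightarrow> hdot (g *v z) (g *v w) = hdot z w"
  by (simp add: hdot_matrix matrix_vector_mul_assoc SU3_D)

lemma SU3_norm: "g \<in> SU3 \<Longrightarrow> norm (g *v z) = norm z"
  using SU3_hdot[of g z z] unfolding hdot_self
  by (metis norm_ge_zero of_real_eq_iff power2_eq_iff_nonneg)

lemma SU3_nonzero: "g \<in> SU3 \<Longrightarrow> z \<noteq> 0 \<Longrightarrow> g *v z \<noteq> 0"
  using SU3_norm[of g z] by auto

lemma norm_smult: "norm (c *s (z :: complex^3)) = cmod c * norm z"
  by (simp add: norm_vec_def norm_mult L2_set_right_distrib)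

lemma Rep_proj: "z \<noteq> 0 \<Longrightarrow> Rep_CP2 (proj z) = range (\<lambda>k. k *s z)"
  by (simp add: proj_def Abs_CP2_inverse vec.span_singleton[symmetric])

lemma proj_eq_iff:
  assumes "z \<noteq> 0" "w \<noteq> 0"
  shows "proj z = proj w \<longleftrightarrow> (\<exists>c. w = c *s z)"
proof
  assume "proj z = proj w"
  then have "range (\<lambda>k. k *s z) = range (\<lambda>k. k *s w)"
    using assms by (metis Rep_proj)
  moreover have "w \<in> range (\<lambda>k. k *s w)" by (rule image_eqI[of _ _ 1]) auto
  ultimately show "\<exists>c. w = c *s z" by auto
next
  assume "\<exists>c. w = c *s z"
  then obtain c where c: "w = c *s z" by auto
  with assms have "c \<noteq> 0" by auto
  then have "range (\<lambda>k. k *s z) = range (\<lambda>k. k *s w)"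
  proof (intro equalityI subsetI)
    fix x assume "x \<in> range (\<lambda>k. k *s z)"
    then obtain k where "x = k *s z" by auto
    then have "x = (k / c) *s w" using \<open>c \<noteq> 0\<close> by (simp add: c)
    then show "x \<in> range (\<lambda>k. k *s w)" by auto
  qed (auto simp: c)
  then show "proj z = proj w" using assms by (metis Rep_proj Rep_CP2_inject)
qed

lemma exists_unit_rep: "\<exists>n. norm n = 1 \<and> proj n = x"
proof -
  have x: "vec.subspace (Rep_CP2 x)" "vec.dim (Rep_CP2 x) = 1"
    using Rep_CP2[of x] by auto
  obtain B where B: "B \<subseteq> Rep_CP2 x" "vec.independent B" "Rep_CP2 x \<subseteq> vec.span B" "card B = vec.dim (Rep_CP2 x)"
    by (rule vec.basis_exists)
  then obtain z where z: "B = {z}" using x by (auto simp: card_1_singleton_iff)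
  with B have "z \<noteq> 0" by auto
  have "Rep_CP2 x = vec.span {z}"
    using B x z by (metis vec.span_subspace)
  then have "x = proj z" by (metis Rep_CP2_inverse proj_def)
  also have "\<dots> = proj (of_real (1 / norm z) *s z)"
    using \<open>z \<noteq> 0\<close> by (subst proj_eq_iff) auto
  finally show ?thesis using \<open>z \<noteq> 0\<close>
    by (intro exI[of _ "of_real (1 / norm z) *s z"]) (simp add: norm_smult norm_divide)
qed

lemma act_proj:
  assumes "g \<in> SU3" "z \<noteq> 0"
  shows "act g (proj z) = proj (g *v z)"
proof -
  have "(*v) g ` range (\<lambda>k. k *s z) = range (\<lambda>k. k *s (g *v z))"
    by (auto simp: image_iff vector_scalar_commute)
  then have "act g (proj z) = Abs_CP2 (Rep_CP2 (proj (g *v z)))"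
    unfolding act_def using assms SU3_nonzero[OF assms] by (simp add: Rep_proj)
  then show ?thesis by (simp add: Rep_CP2_inverse)
qed

abbreviation e1 :: "complex^3" where
  "e1 \<equiv> vector [1, 0, 0]"

lemma norm_e1 [simp]: "norm e1 = 1"
  by (simp add: norm_vec_def L2_set_def sum_3)

lemma e1_nonzero [simp]: "e1 \<noteq> 0"
  by (metis norm_e1 norm_zero zero_neq_one)

text \<open>The third column is the conjugated cross product of the first two.\<close>

lemma SU3_of_orthonormal_pair:
  assumes z: "hdot z z = 1" and v: "hdot v v = 1" and o: "hdot z v = 0"
  shows "\<exists>g\<in>SU3. g *v e1 = z"
proof -
  define w :: "complex^3" where "w = vector [cnj (z$2 * v$3 - z$3 * v$2), cnj (z$3 * v$1 - z$1 * v$3), cnj (z$1 * v$2 - z$2 * v$1)]"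
  define g :: "complex^3^3" where "g = (\<chi> i j. if j = 1 then z $ i else if j = 2 then v $ i else w $ i)"
  have w: "w $ 1 = cnj (z$2 * v$3 - z$3 * v$2)" "w $ 2 = cnj (z$3 * v$1 - z$1 * v$3)" "w $ 3 = cnj (z$1 * v$2 - z$2 * v$1)"
    by (simp_all add: w_def)
  have o': "hdot v z = 0"
    using arg_cong[OF o, of cnj] by (simp add: hdot_def mult.commute)
  have zw: "hdot z w = 0" "hdot v w = 0"
    by (simp_all add: hdot_def sum_3 w algebra_simps)
  have wz: "hdot w z = 0" "hdot w v = 0"
    by (simp_all add: hdot_def sum_3 w algebra_simps)
  \<comment> \<open>Lagrange's identity for the norm of a cross product.\<close>
  have "hdot w w = hdot z z * hdot v v - hdot z v * hdot v z"
    by (simp add: hdot_def sum_3 w algebra_simps)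
  then have ww: "hdot w w = 1" using z v o by simp
  \<comment> \<open>The determinant is the triple product of w with the cross product of z and v,
    and the latter is the conjugate of w.\<close>
  have "det g = hdot w w"
    by (simp add: det_3 g_def hdot_def sum_3 w algebra_simps)
  then have "det g = 1" using ww by simp
  moreover have "(cadj g ** g) $ i $ j
      = hdot (if i = 1 then z else if i = 2 then v else w) (if j = 1 then z else if j = 2 then v else w)" for i j
    by (simp add: matrix_matrix_mult_def cadj_def g_def hdot_def)
  then have "(cadj g ** g) $ i $ j = mat 1 $ i $ j" for i j
    using exhaust_3[of i] exhaust_3[of j] z v o o' zw wz ww by (auto simp: mat_def)
  then have "cadj g ** g = mat 1" by (simp add: vec_eq_iff)
  moreover have "g *v e1 = z"
    by (simp add: vec_eq_iff matrix_vector_mult_def sum_3 g_def)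
  ultimately show ?thesis by (auto simp: SU3_def)
qed

lemma SU3_transitive:
  assumes "norm z = 1"
  shows "\<exists>g\<in>SU3. g *v e1 = z"
proof -
  have z: "hdot z z = 1" using assms by (simp add: hdot_self)
  define s where "s = sqrt ((cmod (z$1))\<^sup>2 + (cmod (z$2))\<^sup>2)"
  show ?thesis
  proof (cases "s = 0")
    case True
    then have "z $ 1 = 0" "z $ 2 = 0" by (auto simp: s_def add_nonneg_eq_0_iff)
    then show ?thesis
      using z by (intro SU3_of_orthonormal_pair[of z e1]) (auto simp: hdot_def sum_3)
  next
    case False
    \<comment> \<open>A rotation by a right angle inside the first two coordinates gives a vector
      orthogonal to z. It degenerates when both coordinates are 0, the case in which
      \<open>e1\<close> served instead.\<close>
    define v :: "complex^3" where "v = vector [- cnj (z$2) / of_real s, cnj (z$1) / of_real s, 0]"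
    have s2: "complex_of_real s * complex_of_real s = z$1 * cnj (z$1) + z$2 * cnj (z$2)"
      unfolding complex_norm_square[symmetric] of_real_mult[symmetric] of_real_add[symmetric] by (simp add: s_def flip: power2_eq_square)
    have "hdot v v = (z$1 * cnj (z$1) + z$2 * cnj (z$2)) / (of_real s * of_real s)"
      by (simp add: hdot_def sum_3 v_def add_divide_distrib mult.commute)
    then have "hdot v v = 1" using False by (simp add: s2[symmetric])
    moreover have "hdot z v = 0" by (simp add: hdot_def sum_3 v_def mult.commute)
    ultimately show ?thesis using z by (intro SU3_of_orthonormal_pair)
  qed
qed

lemma CP2_orbit: "\<exists>g\<in>SU3. x = act g x0"
proof -
  obtain n where n: "norm n = 1" "proj n = x" using exists_unit_rep by blast
  then obtain g where "g \<in> SU3" "g *v e1 = n" using SU3_transitive by blast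
  then show ?thesis using n by (intro bexI[of _ g]) (auto simp: x0_def act_proj)
qed

section \<open>Independence of the representative\<close>

lemma Phi_smult: "Phi p (c *s z) a = c ^ p * Phi p z a"
  by (cases a) (auto simp: Phi_eq mpower_def idx_def power_mult_distrib power_add)

lemma qform_smult: "qform p A (c *s z) = of_real (cmod c ^ (2 * p)) * qform p A z"
proof -
  have "cnj c ^ p * c ^ p = of_real (cmod c ^ (2 * p))"
  proof -
    have "cnj c ^ p * c ^ p = of_real ((cmod c)\<^sup>2) ^ p"
      unfolding complex_norm_square by (simp add: power_mult_distrib mult.commute)
    then show ?thesis by (simp add: power_mult)
  qed
  then show ?thesis
    by (simp add: qform_sum Phi_smult sum_distrib_left split_beta) (intro sum.cong refl, metis (no_types, lifting) mult.assoc mult.left_commute)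
qed

text \<open>\<open>berezin\<close> picks an arbitrary unit representative. Two of them differ by a
  phase, and \<open>qform\<close> scales by a power of its modulus, which is 1.\<close>

lemma berezin_unit:
  assumes "norm n = 1"
  shows "berezin p A (proj n) = qform p A n"
proof -
  define m where "m = (SOME m. norm m = 1 \<and> proj m = proj n)"
  have m: "norm m = 1" "proj m = proj n"
    unfolding m_def using someI[of "\<lambda>m. norm m = 1 \<and> proj m = proj n" n] assms by auto
  then obtain c where c: "m = c *s n"
    using proj_eq_iff[of n m] assms by force
  with m assms have "cmod c = 1" by (simp add: norm_smult)
  then have "qform p A m = qform p A n" by (simp add: c qform_smult)
  then show ?thesis by (simp add: berezin_def qform_def m_def Let_def)
qed

lemma berezin_proj:
  assumes "z \<noteq> 0"
  shows "berezin p A (proj z) = qform p A z / of_real (norm z ^ (2 * p))"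
proof -
  have "proj z = proj (of_real (1 / norm z) *s z)"
    using assms by (subst proj_eq_iff) auto
  then have "berezin p A (proj z) = qform p A (of_real (1 / norm z) *s z)"
    using assms by (simp add: berezin_unit norm_smult norm_divide)
  then show ?thesis by (simp add: qform_smult norm_divide power_divide)
qed

lemma qform_zero_of_unit:
  assumes "\<And>n. norm n = 1 \<Longrightarrow> qform p A n = 0"
  shows "qform p A z = 0"
proof (cases "z = 0")
  case True
  \<comment> \<open>The scaling factor \<open>0 ^ (2 * p)\<close> is 1 when p = 0, so the value is
    made to vanish through the unit vector \<open>e1\<close> instead.\<close>
  then have "qform p A z = qform p A (0 *s e1)" by simp
  also have "\<dots> = 0" using assms[of e1] by (simp only: qform_smult) simp
  finally show ?thesis .
next
  case False
  then have "qform p A (of_real (norm z) *s (of_real (1 / norm z) *s z)) = 0"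
    using assms by (subst qform_smult) (simp add: norm_smult norm_divide)
  moreover have "of_real (norm z) *s (of_real (1 / norm z) *s z) = z"
    using False by (simp add: vec_eq_iff)
  ultimately show ?thesis by simp
qed

lemma Phi_norm: "norm n = 1 \<Longrightarrow> cip (idx p) (Phi p n) (Phi p n) = 1"
  using hdot_self[of n] by (simp add: cip_Phi hdot_def)

section \<open>The symbol map\<close>

text \<open>A class of functions closed under taking directional derivatives, so membership alone
  yields \<open>Ck k\<close> for every k. Bounded linear means real-linear, which admits conjugated
  coordinates. Inversion asks for a denominator without zeros anywhere, as is the case in the affine
  charts.\<close>

inductive smooth_alg :: "('a::real_normed_vector \<Rightarrow> complex) \<Rightarrow> bool" where
  const: "smooth_alg (\<lambda>_. c)"
| linear: "bounded_linear f \<Longrightarrow> smooth_alg f"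
| add: "smooth_alg f \<Longrightarrow> smooth_alg g \<Longrightarrow> smooth_alg (\<lambda>x. f x + g x)"
| mult: "smooth_alg f \<Longrightarrow> smooth_alg g \<Longrightarrow> smooth_alg (\<lambda>x. f x * g x)"
| inverse: "smooth_alg f \<Longrightarrow> (\<And>x. f x \<noteq> 0) \<Longrightarrow> smooth_alg (\<lambda>x. inverse (f x))"

lemma smooth_alg_derivative:
  "smooth_alg f \<Longrightarrow> \<exists>f'. (\<forall>x. (f has_derivative f' x) (at x)) \<and> (\<forall>v. smooth_alg (\<lambda>x. f' x v))"
proof (induction rule: smooth_alg.induct)
  case (const c)
  show ?case by (rule exI[of _ "\<lambda>_ _. 0"]) (auto intro: smooth_alg.const)
next
  case (linear f)
  then show ?case
    by (intro exI[of _ "\<lambda>_. f"]) (auto intro: smooth_alg.const bounded_linear_imp_has_derivative)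
next
  case (add f g)
  then obtain f' g' where "\<forall>x. (f has_derivative f' x) (at x)" "\<forall>v. smooth_alg (\<lambda>x. f' x v)"
    "\<forall>x. (g has_derivative g' x) (at x)" "\<forall>v. smooth_alg (\<lambda>x. g' x v)" by blast
  then show ?case
    by (intro exI[of _ "\<lambda>x v. f' x v + g' x v"]) (auto intro: smooth_alg.add has_derivative_add)
next
  case (mult f g)
  then obtain f' g' where "\<forall>x. (f has_derivative f' x) (at x)" "\<forall>v. smooth_alg (\<lambda>x. f' x v)"
    "\<forall>x. (g has_derivative g' x) (at x)" "\<forall>v. smooth_alg (\<lambda>x. g' x v)" by blast
  then show ?case
    using mult.hyps
    by (intro exI[of _ "\<lambda>x v. f x * g' x v + f' x v * g x"] conjI allI has_derivative_mult
        smooth_alg.add smooth_alg.mult) auto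
next
  case (inverse f)
  then obtain f' where f': "\<forall>x. (f has_derivative f' x) (at x)" "\<forall>v. smooth_alg (\<lambda>x. f' x v)" by blast
  have "smooth_alg (\<lambda>x. inverse (f x))" using inverse.hyps by (intro smooth_alg.inverse)
  then have "smooth_alg (\<lambda>x. (- 1) * (inverse (f x) * f' x v * inverse (f x)))" for v
    using f' by (intro smooth_alg.mult smooth_alg.const) auto
  then show ?case
    using f' inverse.hyps
    by (intro exI[of _ "\<lambda>x v. - (inverse (f x) * f' x v * inverse (f x))"]) (auto intro: has_derivative_inverse)
qed

lemma smooth_alg_Ck: "smooth_alg f \<Longrightarrow> Ck k f"
proof (induction k arbitrary: f)
  case 0
  then show ?case
    using smooth_alg_derivative[OF 0] by (auto intro: has_derivative_continuous simp: continuous_on_eq_continuous_at)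
next
  case (Suc k)
  obtain f' where f': "\<And>x. (f has_derivative f' x) (at x)" "\<And>v. smooth_alg (\<lambda>x. f' x v)"
    using smooth_alg_derivative[OF Suc.prems] by blast
  then have "frechet_derivative f (at x) = f' x" for x
    by (metis frechet_derivative_at)
  then show ?case using f' Suc.IH by (auto simp: differentiable_def)
qed

lemma smooth_alg_sum: "(\<And>t. t \<in> T \<Longrightarrow> smooth_alg (f t)) \<Longrightarrow> smooth_alg (\<lambda>x. \<Sum>t\<in>T. f t x)"
  by (induction T rule: infinite_finite_induct) (auto intro: smooth_alg.intros)

lemma smooth_alg_power: "smooth_alg f \<Longrightarrow> smooth_alg (\<lambda>x. f x ^ n)"
  by (induction n) (auto intro: smooth_alg.intros)

text \<open>The norm is traded for the polynomial \<open>hdot z z\<close>, which has the shape that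
  \<open>smooth_alg\<close> and the continuity rules can handle.\<close>

lemma berezin_proj_hdot: "z \<noteq> 0 \<Longrightarrow> berezin p A (proj z) = qform p A z * inverse (hdot z z ^ p)"
  by (simp add: berezin_proj hdot_self divide_inverse power_mult)

text \<open>\<open>smooth_alg\<close> has no clause for conjugation, so the conjugated coordinates
  enter as a separate hypothesis.\<close>

lemma smooth_alg_berezin:
  assumes "\<And>i. smooth_alg (\<lambda>x. z x $ i)" "\<And>i. smooth_alg (\<lambda>x. cnj (z x $ i))" "\<And>x. z x \<noteq> 0"
  shows "smooth_alg (\<lambda>x. berezin p A (proj (z x)))"
proof -
  have m: "smooth_alg (\<lambda>x. mpower (z x) a)" "smooth_alg (\<lambda>x. cnj (mpower (z x) a))" for a
    using assms(1,2) by (cases a; simp add: mpower_def; intro smooth_alg.mult smooth_alg_power; simp)+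
  have Phi: "smooth_alg (\<lambda>x. Phi p (z x) a)" "smooth_alg (\<lambda>x. cnj (Phi p (z x) a))" for a
    using m[of a] by (cases "a \<in> idx p"; simp add: Phi_eq smooth_alg.const smooth_alg.mult)+
  have "smooth_alg (\<lambda>x. qform p A (z x))"
    unfolding qform_sum split_beta by (intro smooth_alg_sum smooth_alg.mult smooth_alg.const Phi)
  moreover have "smooth_alg (\<lambda>x. hdot (z x) (z x) ^ p)"
    unfolding hdot_def by (intro smooth_alg_power smooth_alg_sum smooth_alg.mult assms)
  then have "smooth_alg (\<lambda>x. inverse (hdot (z x) (z x) ^ p))"
    using assms(3) by (intro smooth_alg.inverse) (auto simp: hdot_self)
  ultimately show ?thesis
    using assms(3) by (simp add: berezin_proj_hdot smooth_alg.mult)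
qed

lemma smooth_berezin: "smooth_CP2 (berezin p A)"
proof -
  have lin: "smooth_alg (fst :: complex \<times> complex \<Rightarrow> complex)" "smooth_alg (snd :: complex \<times> complex \<Rightarrow> complex)"
    "smooth_alg (\<lambda>x :: complex \<times> complex. cnj (fst x))" "smooth_alg (\<lambda>x :: complex \<times> complex. cnj (snd x))"
    by (intro smooth_alg.linear bounded_linear_fst bounded_linear_snd
        bounded_linear_compose[OF bounded_linear_cnj bounded_linear_fst]
        bounded_linear_compose[OF bounded_linear_cnj bounded_linear_snd])+
  have chart: "smooth_alg (\<lambda>x. berezin p A (proj (vector [f x, g x, h x])))"
    if "smooth_alg f" "smooth_alg g" "smooth_alg h"
      "smooth_alg (\<lambda>x. cnj (f x))" "smooth_alg (\<lambda>x. cnj (g x))" "smooth_alg (\<lambda>x. cnj (h x))"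
      "\<And>x. f x \<noteq> 0 \<or> g x \<noteq> 0 \<or> h x \<noteq> 0" for f g h :: "complex \<times> complex \<Rightarrow> complex"
  proof (rule smooth_alg_berezin)
    fix i :: 3
    show "smooth_alg (\<lambda>x. vector [f x, g x, h x] $ i)"
      "smooth_alg (\<lambda>x. cnj (vector [f x, g x, h x] $ i))"
      using exhaust_3[of i] that by auto
  next
    fix x
    show "vector [f x, g x, h x] \<noteq> (0 :: complex^3)"
      using that(7)[of x] by (auto simp: vec_eq_iff forall_3)
  qed
  show ?thesis
    unfolding smooth_CP2_def case_prod_unfold
    using chart[of "\<lambda>_. 1" fst snd] chart[of fst "\<lambda>_. 1" snd] chart[of fst snd "\<lambda>_. 1"]
    by (intro allI conjI smooth_alg_Ck) (simp_all add: lin smooth_alg.const)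
qed

section \<open>Continuity in the quotient topology, for measurability\<close>

lemma continuous_on_Phi: "continuous_on S (\<lambda>z. Phi p z a)"
  by (cases a; cases "a \<in> idx p") (auto simp: Phi_eq mpower_def intro!: continuous_intros)

lemma continuous_on_berezin: "continuous_on UNIV (berezin p A)"
proof -
  have "continuous_on (- {0}) (\<lambda>z. qform p A z * inverse (hdot z z ^ p))"
    unfolding qform_sum split_beta hdot_def
    by (intro continuous_intros continuous_on_Phi) (auto simp: hdot_self[unfolded hdot_def])
  then have "open (- {0} \<inter> (\<lambda>z. qform p A z * inverse (hdot z z ^ p)) -` S)" if "open S" for S
    using that by (intro continuous_open_preimage) auto
  moreover have "{z. z \<noteq> 0 \<and> proj z \<in> berezin p A -` S}
      = - {0} \<inter> (\<lambda>z. qform p A z * inverse (hdot z z ^ p)) -` S" for S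
    by (auto simp: berezin_proj_hdot)
  ultimately show ?thesis
    unfolding continuous_on_open_vimage[OF open_UNIV] open_CP2_def by simp
qed

lemma continuous_on_act:
  assumes "g \<in> SU3"
  shows "continuous_on UNIV (act g)"
proof -
  have "continuous_on (- {0}) ((*v) g)"
    unfolding matrix_vector_mult_def by (intro continuous_intros)
  then have "open (- {0} \<inter> (*v) g -` {z. z \<noteq> 0 \<and> proj z \<in> S})" if "open S" for S
    using that by (intro continuous_open_preimage) (auto simp: open_CP2_def)
  moreover have "{z. z \<noteq> 0 \<and> proj z \<in> act g -` S} = - {0} \<inter> (*v) g -` {z. z \<noteq> 0 \<and> proj z \<in> S}" for S
    by (auto simp: act_proj[OF assms] SU3_nonzero[OF assms])
  ultimately show ?thesis
    unfolding continuous_on_open_vimage[OF open_UNIV] by (simp add: open_CP2_def)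
qed

section \<open>Equivariance, reality and injectivity\<close>

lemma cip_mv: "cip I v (mv I A w) = cip I (mv I (op_adj A) v) w"
proof -
  have "cip I v (mv I A w) = (\<Sum>a\<in>I. \<Sum>b\<in>I. cnj (v a) * (A (a, b) * w b))"
    by (simp add: cip_def mv_def sum_distrib_left)
  also have "\<dots> = (\<Sum>b\<in>I. \<Sum>a\<in>I. cnj (v a) * (A (a, b) * w b))"
    by (rule sum.swap)
  finally show ?thesis
    by (simp add: cip_def mv_def op_adj_def sum_distrib_left sum_distrib_right mult_ac)
qed

lemma mv_mm: "mv I (mm I A B) v = mv I A (mv I B v)"
proof
  fix a
  have "mv I (mm I A B) v a = (\<Sum>c\<in>I. \<Sum>b\<in>I. A (a, b) * (B (b, c) * v c))"
    by (simp add: mv_def mm_def sum_distrib_right mult.assoc)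
  also have "\<dots> = (\<Sum>b\<in>I. \<Sum>c\<in>I. A (a, b) * (B (b, c) * v c))"
    by (rule sum.swap)
  finally show "mv I (mm I A B) v a = mv I A (mv I B v) a"
    by (simp add: mv_def sum_distrib_left)
qed

text \<open>The left factor of \<open>op_rep\<close> moves across the inner product as its adjoint,
  which is \<open>sym_rep\<close> of \<open>cadj g\<close>, that is, of the inverse. Both coherent
  vectors are then moved by the same matrix.\<close>

lemma qform_op_rep:
  assumes "g \<in> SU3"
  shows "qform p (op_rep p g A) z = qform p A (matrix_inv g *v z)"
  unfolding qform_def op_rep_def mv_mm
  by (simp add: cip_mv[of _ _ "sym_rep p g"] flip: sym_rep_cadj)
    (simp add: sym_rep_Phi SU3_D(4)[OF assms])

lemma berezin_op_rep:
  assumes "g \<in> SU3"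
  shows "berezin p (op_rep p g A) x = berezin p A (act (matrix_inv g) x)"
proof -
  obtain n where n: "norm n = 1" "x = proj n" using exists_unit_rep by metis
  have "n \<noteq> 0" using n(1) by force
  then have "act (matrix_inv g) x = proj (cadj g *v n)"
    unfolding n(2) SU3_D(4)[OF assms] by (rule act_proj[OF SU3_D(5)[OF assms]])
  moreover have "norm (cadj g *v n) = 1"
    using SU3_norm[OF SU3_D(5)[OF assms]] n(1) by simp
  ultimately show ?thesis
    by (simp only: n(2) berezin_unit[OF n(1)] berezin_unit qform_op_rep[OF assms] SU3_D(4)[OF assms])
qed

lemma qform_op_adj: "qform p (op_adj A) z = cnj (qform p A z)"
proof -
  have "cip I v w = cnj (cip I w v)" for I :: "midx set" and v w
    by (simp add: cip_def mult.commute)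
  then show ?thesis unfolding qform_def by (subst cip_mv[of _ _ A])
qed

lemma qform_add: "qform p (\<lambda>i. A i + B i) z = qform p A z + qform p B z"
  by (simp add: qform_sum split_beta distrib_right sum.distrib)

lemma qform_cmult: "qform p (\<lambda>i. c * A i) z = c * qform p A z"
  by (simp add: qform_sum split_beta sum_distrib_left mult.assoc)

lemma inj_on_berezin: "inj_on (berezin p) (ops p)"
proof (rule inj_onI)
  fix A B assume AB: "A \<in> ops p" "B \<in> ops p" "berezin p A = berezin p B"
  have "qform p (\<lambda>i. A i + (- 1) * B i) z = 0" for z
  proof (rule qform_zero_of_unit)
    fix n :: "complex^3" assume "norm n = 1"
    then show "qform p (\<lambda>i. A i + (- 1) * B i) n = 0"
      using AB(3) unfolding qform_add qform_cmult by (simp flip: berezin_unit)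
  qed
  from qform_zero_imp[OF this] have "A (a, b) = B (a, b)" if "a \<in> idx p" "b \<in> idx p" for a b
    using that by fastforce
  then have "A i = B i" for i
    using AB(1,2) by (cases i; cases "i \<in> idx p \<times> idx p") (auto simp: cspace_def)
  then show "A = B" by auto
qed

text \<open>The rank-one operator built from \<open>Phi p z\<close> and its dual; for unit z it is
  the orthogonal projection onto the coherent line.\<close>

definition projector :: "nat \<Rightarrow> complex^3 \<Rightarrow> (midx \<times> midx) cvec" where
  "projector p z = tensor (Phi p z) (dual_vec (Phi p z))"

lemma qform_projector: "qform p A z = op_trace (idx p) (mm (idx p) A (projector p z))"
  by (simp add: qform_def cip_def mv_def op_trace_def mm_def projector_def tensor_def dual_vec_def
      sum_distrib_left mult_ac)

lemma mm_tensor: "mm I A (tensor v \<phi>) = tensor (mv I A v) \<phi>"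
  by (auto simp: fun_eq_iff mm_def mv_def tensor_def sum_distrib_right mult.assoc)

lemma mm_tensor_adj: "mm I (tensor v (dual_vec w)) (op_adj B) = tensor v (dual_vec (mv I B w))"
  by (auto simp: fun_eq_iff mm_def mv_def tensor_def dual_vec_def op_adj_def sum_distrib_left mult_ac)

lemma op_rep_projector:
  assumes "g \<in> SU3"
  shows "op_rep p g (projector p z) = projector p (g *v z)"
  by (simp add: op_rep_def projector_def sym_rep_Phi SU3_D(4)[OF assms] sym_rep_cadj mm_tensor mm_tensor_adj)

lemma Phi_in_cspace: "Phi p z \<in> cspace (idx p)"
  by (simp add: cspace_def Phi_eq)

lemma projector_in_ops: "projector p z \<in> ops p"
  by (auto simp: cspace_def projector_def tensor_def dual_vec_def Phi_eq)

lemma projector_smult: "cmod c = 1 \<Longrightarrow> projector p (c *s z) = projector p z"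
proof
  fix ab assume "cmod c = 1"
  then have "c ^ p * cnj c ^ p = 1"
    using complex_norm_square[of c, symmetric] by (simp flip: power_mult_distrib)
  then have "c ^ p * x * (cnj c ^ p * y) = x * y" for x y
    by (simp add: mult_ac)
  then show "projector p (c *s z) ab = projector p z ab"
    by (cases ab) (simp add: projector_def tensor_def dual_vec_def Phi_smult)
qed

lemma projector_e1: "projector p e1 = (\<lambda>(a, b). if a = (p, 0, 0) \<and> b = (p, 0, 0) then 1 else 0)"
  by (auto simp: fun_eq_iff projector_def tensor_def dual_vec_def Phi_eq mpower_def idx_def
      multinom_def power_0_left)

text \<open>Indices with positive first entry are a shifted copy of the previous set; those with
  first entry 0 number p + 2. This is the recursion of the triangular numbers.\<close>

lemma card_idx: "real (card (idx p)) = irrep_dim p 0"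
proof (induction p)
  case 0
  have "idx 0 = {(0, 0, 0)}" by (auto simp: idx_def)
  then show ?case by (simp add: irrep_dim_def)
next
  case (Suc p)
  define f :: "midx \<Rightarrow> midx" where "f = (\<lambda>(j, k, l). (Suc j, k, l))"
  define h :: "nat \<Rightarrow> midx" where "h = (\<lambda>k. (0, k, Suc p - k))"
  have "x \<in> idx (Suc p) \<longleftrightarrow> x \<in> f ` idx p \<union> h ` {..Suc p}" for x
  proof -
    obtain j k l where "x = (j, k, l)" by (cases x)
    then show ?thesis by (cases j) (auto simp: idx_def f_def h_def image_iff)
  qed
  then have "idx (Suc p) = f ` idx p \<union> h ` {..Suc p}" by blast
  moreover have "f ` idx p \<inter> h ` {..Suc p} = {}"
    by (auto simp: f_def h_def)
  moreover have "card (f ` idx p) = card (idx p)"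
    by (rule card_image) (auto simp: inj_on_def f_def)
  moreover have "card (h ` {..Suc p}) = p + 2"
    by (subst card_image) (auto simp: inj_on_def h_def)
  ultimately have "card (idx (Suc p)) = card (idx p) + (p + 2)"
    by (simp add: card_Un_disjoint)
  then show ?case using Suc by (simp add: irrep_dim_def field_simps)
qed

lemma irrep_dim_pos: "irrep_dim p 0 > 0"
  by (simp add: irrep_dim_def)

lemma irrep_dim_nonzero [simp]: "irrep_dim p 0 \<noteq> 0"
  using irrep_dim_pos[of p] by simp

section \<open>The integral of a symbol\<close>

lemma cmod_Phi_le:
  assumes "norm n = 1"
  shows "cmod (Phi p n a) \<le> 1"
proof (cases "a \<in> idx p")
  case True
  have "(\<Sum>a\<in>idx p. complex_of_real ((cmod (Phi p n a))\<^sup>2)) = 1"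
    unfolding complex_norm_square using Phi_norm[OF assms, of p] by (simp add: cip_def mult.commute)
  then have s: "(\<Sum>a\<in>idx p. (cmod (Phi p n a))\<^sup>2) = 1"
    unfolding of_real_sum[symmetric] of_real_eq_1_iff .
  have "(cmod (Phi p n a))\<^sup>2 \<le> 1"
    unfolding s[symmetric] using True by (intro member_le_sum) auto
  then show ?thesis by (simp add: power2_le_imp_le)
qed (simp add: Phi_eq)

lemma cmod_berezin_le: "cmod (berezin p A x) \<le> (\<Sum>t\<in>idx p \<times> idx p. cmod (A t))"
proof -
  obtain n where n: "norm n = 1" "x = proj n" using exists_unit_rep by metis
  have "cmod (qform p A n) \<le> (\<Sum>t\<in>idx p \<times> idx p. cmod (A t) * (cmod (Phi p n (fst t)) * cmod (Phi p n (snd t))))"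
    unfolding qform_sum by (rule order_trans[OF norm_sum]) (simp add: split_beta norm_mult)
  also have "\<dots> \<le> (\<Sum>t\<in>idx p \<times> idx p. cmod (A t) * (1 * 1))"
    by (intro sum_mono mult_mono cmod_Phi_le n) auto
  finally show ?thesis by (simp add: n(2) berezin_unit[OF n(1)])
qed

definition op_unit :: "midx \<times> midx \<Rightarrow> (midx \<times> midx) cvec" where
  "op_unit t = (\<lambda>i. if i = t then 1 else 0)"

lemma qform_op_unit:
  assumes "t \<in> idx p \<times> idx p"
  shows "qform p (op_unit t) z = cnj (Phi p z (fst t)) * Phi p z (snd t)"
proof -
  have "qform p (op_unit t) z
      = (\<Sum>s\<in>idx p \<times> idx p. if s = t then cnj (Phi p z (fst t)) * Phi p z (snd t) else 0)"
    unfolding qform_sum by (intro sum.cong refl) (auto simp: op_unit_def)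
  then show ?thesis using assms by simp
qed

lemma berezin_expand: "berezin p A x = (\<Sum>t\<in>idx p \<times> idx p. A t * berezin p (op_unit t) x)"
proof -
  obtain n where n: "norm n = 1" "x = proj n" using exists_unit_rep by metis
  have "qform p A n = (\<Sum>t\<in>idx p \<times> idx p. A t * qform p (op_unit t) n)"
    unfolding qform_sum[of p A] by (intro sum.cong refl) (auto simp: qform_op_unit)
  then show ?thesis by (simp add: n(2) berezin_unit[OF n(1)])
qed

lemma measurable_berezin:
  assumes "invariant_prob \<mu>"
  shows "berezin p A \<in> borel_measurable \<mu>"
proof -
  have "berezin p A \<in> borel_measurable borel"
    by (rule borel_measurable_continuous_onI[OF continuous_on_berezin])
  then show ?thesis using assms by (simp add: invariant_prob_def cong: measurable_cong_sets)
qed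

lemma integrable_berezin:
  assumes "invariant_prob \<mu>"
  shows "integrable \<mu> (berezin p A)"
proof -
  interpret prob_space \<mu> using assms by (simp add: invariant_prob_def)
  show ?thesis
    by (rule integrable_const_bound[of _ "\<Sum>t\<in>idx p \<times> idx p. cmod (A t)"])
      (auto simp: cmod_berezin_le measurable_berezin[OF assms])
qed

lemma integral_berezin_op_rep:
  assumes "invariant_prob \<mu>" and "g \<in> SU3"
  shows "(LINT x|\<mu>. berezin p (op_rep p g A) x) = (LINT x|\<mu>. berezin p A x)"
proof -
  have h: "matrix_inv g \<in> SU3" using SU3_D(4,5)[OF assms(2)] by simp
  have "act (matrix_inv g) \<in> measurable borel borel"
    by (rule borel_measurable_continuous_onI[OF continuous_on_act[OF h]])
  then have m: "act (matrix_inv g) \<in> measurable \<mu> borel"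
    using assms(1) by (simp add: invariant_prob_def cong: measurable_cong_sets)
  have "(LINT x|\<mu>. berezin p (op_rep p g A) x) = (LINT x|\<mu>. berezin p A (act (matrix_inv g) x))"
    by (simp add: berezin_op_rep[OF assms(2)])
  also have "\<dots> = (LINT x|distr \<mu> borel (act (matrix_inv g)). berezin p A x)"
    by (rule integral_distr[symmetric, OF m]) (rule borel_measurable_continuous_onI[OF continuous_on_berezin])
  also have "distr \<mu> borel (act (matrix_inv g)) = \<mu>"
    using assms(1) h by (simp add: invariant_prob_def)
  finally show ?thesis .
qed

lemma integral_berezin_expand:
  assumes "invariant_prob \<mu>"
  shows "(LINT x|\<mu>. berezin p A x) = (\<Sum>t\<in>idx p \<times> idx p. A t * (LINT x|\<mu>. berezin p (op_unit t) x))"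
  unfolding berezin_expand[of p A]
  by (subst Bochner_Integration.integral_sum) (auto intro: integrable_berezin[OF assms])

lemma berezin_op_id: "berezin p (op_id (idx p)) x = 1"
proof -
  obtain n where n: "norm n = 1" "x = proj n" using exists_unit_rep by metis
  have "mv (idx p) (op_id (idx p)) v a = v a" if "a \<in> idx p" for v a
    using that by (simp add: mv_def op_id_def if_distrib[where f = "\<lambda>x. x * _"] cong: if_cong)
  then have "qform p (op_id (idx p)) n = cip (idx p) (Phi p n) (Phi p n)"
    by (simp add: qform_def cip_def)
  then show ?thesis using n by (simp add: berezin_unit Phi_norm)
qed

text \<open>On projectors onto coherent states the integral is constant by transitivity; the difference
  with the matching multiple of the trace is the quadratic form of some operator, which vanishes by
  injectivity. This replaces an appeal to Schur's lemma.\<close>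

lemma integral_berezin:
  assumes "invariant_prob \<mu>"
  shows "(LINT x|\<mu>. berezin p A x) = op_trace (idx p) A / of_real (irrep_dim p 0)"
proof -
  define L where "L A = (LINT x|\<mu>. berezin p A x)" for A
  define q where "q = L (projector p e1)"
  \<comment> \<open>The indices are swapped because \<open>projector p n\<close> has the entry
    \<open>Phi p n a * cnj (Phi p n b)\<close> at \<open>(a, b)\<close>, while \<open>qform\<close>
    gives this weight to the entry at \<open>(b, a)\<close>. On unit vectors the diagonal part
    subtracts exactly \<open>q\<close>.\<close>
  define D where "D = (\<lambda>(b, a). L (op_unit (a, b)) - (if a = b then q else 0))"
  have expand: "L A = (\<Sum>t\<in>idx p \<times> idx p. A t * L (op_unit t))" for A
    unfolding L_def by (rule integral_berezin_expand[OF assms])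
  have "qform p D z = 0" for z
  proof (rule qform_zero_of_unit)
    fix n :: "complex^3" assume n: "norm n = 1"
    then obtain g where g: "g \<in> SU3" "g *v e1 = n" using SU3_transitive by blast
    have "L (projector p n) = q"
      unfolding L_def q_def g(2)[symmetric] op_rep_projector[OF g(1), symmetric]
      by (rule integral_berezin_op_rep[OF assms g(1)])
    moreover have "L (projector p n) = (\<Sum>(a, b)\<in>idx p \<times> idx p. L (op_unit (a, b)) * (cnj (Phi p n b) * Phi p n a))"
      by (subst expand) (auto simp: projector_def tensor_def dual_vec_def split_beta mult_ac)
    moreover have "\<dots> = (\<Sum>a\<in>idx p. \<Sum>b\<in>idx p. L (op_unit (a, b)) * (cnj (Phi p n b) * Phi p n a))"
      by (simp add: sum.cartesian_product)
    moreover have "\<dots> = (\<Sum>b\<in>idx p. \<Sum>a\<in>idx p. L (op_unit (a, b)) * (cnj (Phi p n b) * Phi p n a))"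
      by (rule sum.swap)
    moreover have "qform p D n = (\<Sum>b\<in>idx p. \<Sum>a\<in>idx p. L (op_unit (a, b)) * (cnj (Phi p n b) * Phi p n a)
        - (if a = b then q * (cnj (Phi p n b) * Phi p n a) else 0))"
      by (simp add: qform_sum D_def sum.cartesian_product[symmetric] if_distrib left_diff_distrib
          if_distribR cong: if_cong)
    moreover have "\<dots> = (\<Sum>b\<in>idx p. \<Sum>a\<in>idx p. L (op_unit (a, b)) * (cnj (Phi p n b) * Phi p n a))
        - q * cip (idx p) (Phi p n) (Phi p n)"
      by (simp add: sum_subtractf cip_def sum_distrib_left)
    ultimately show "qform p D n = 0" using Phi_norm[OF n] by simp
  qed
  from qform_zero_imp[OF this] have unit: "L (op_unit (a, b)) = (if a = b then q else 0)"
    if "a \<in> idx p" "b \<in> idx p" for a b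
    using that by (fastforce simp: D_def)
  have trace: "L A = q * op_trace (idx p) A" for A
  proof -
    have "L A = (\<Sum>a\<in>idx p. \<Sum>b\<in>idx p. A (a, b) * L (op_unit (a, b)))"
      by (subst expand) (simp add: sum.cartesian_product)
    also have "\<dots> = (\<Sum>a\<in>idx p. \<Sum>b\<in>idx p. if b = a then A (a, a) * q else 0)"
      by (intro sum.cong refl) (auto simp: unit)
    finally show ?thesis by (simp add: op_trace_def sum_distrib_left mult.commute)
  qed
  interpret prob_space \<mu> using assms by (simp add: invariant_prob_def)
  \<comment> \<open>The identity has constant symbol 1 and trace \<open>irrep_dim p 0\<close>, which
    fixes the constant \<open>q\<close>.\<close>
  have "L (op_id (idx p)) = 1" by (simp add: L_def berezin_op_id prob_space)
  moreover have "op_trace (idx p) (op_id (idx p)) = of_real (irrep_dim p 0)"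
    by (simp add: op_trace_def op_id_def flip: card_idx)
  ultimately have "q = 1 / of_real (irrep_dim p 0)"
    unfolding trace by (simp add: eq_divide_eq)
  then show ?thesis using trace[of A] by (simp add: L_def)
qed

lemma symbol_correspondence_berezin:
  assumes "invariant_prob \<mu>"
  shows "symbol_correspondence \<mu> p (berezin p)"
proof -
  have "berezin p (\<lambda>i. A i + B i) x = berezin p A x + berezin p B x" for A B x
    by (metis (no_types) exists_unit_rep berezin_unit qform_add)
  moreover have "berezin p (\<lambda>i. c * A i) x = c * berezin p A x" for A c x
    by (metis (no_types) exists_unit_rep berezin_unit qform_cmult)
  moreover have "berezin p (op_adj A) x = cnj (berezin p A x)" for A x
    by (metis (no_types) exists_unit_rep berezin_unit qform_op_adj)
  ultimately show ?thesis
    unfolding symbol_correspondence_def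
    by (auto simp: smooth_berezin inj_on_berezin berezin_op_rep integral_berezin[OF assms])
qed

lemma mapping_positive_berezin: "mapping_positive p (berezin p)"
proof -
  have "(positive_semidefinite (idx p) A \<longrightarrow> berezin p A x \<in> \<real> \<and> Re (berezin p A x) \<ge> 0) \<and>
      (positive_definite (idx p) A \<longrightarrow> berezin p A x \<in> \<real> \<and> Re (berezin p A x) > 0)" for A x
  proof -
    obtain n where n: "norm n = 1" "x = proj n" using exists_unit_rep by metis
    then have "Phi p n \<noteq> (\<lambda>_. 0)" using Phi_norm[of n p] by (auto simp: cip_def)
    then show ?thesis
      using Phi_in_cspace[of p n]
      by (auto simp: n(2) berezin_unit[OF n(1)] qform_def positive_semidefinite_def positive_definite_def)
  qed
  then show ?thesis unfolding mapping_positive_def by blast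
qed

text \<open>An element of the isotropy group multiplies \<open>e1\<close> by a phase, which cancels
  in the projector. At other points the formula is \<open>qform_projector\<close> together with
  equivariance.\<close>

lemma operator_kernel_projector: "operator_kernel p (berezin p) (projector p e1)"
proof -
  have "op_rep p h (projector p e1) = projector p e1" if "h \<in> isotropy" for h
  proof -
    have h: "h \<in> SU3" "act h x0 = x0" using that by (auto simp: isotropy_def)
    then have "proj e1 = proj (h *v e1)" by (simp add: x0_def act_proj)
    then obtain c where c: "h *v e1 = c *s e1"
      using proj_eq_iff[of e1 "h *v e1"] SU3_nonzero[OF h(1)] by auto
    then have "cmod c = 1" using SU3_norm[OF h(1), of e1] by (simp add: norm_smult)
    then show ?thesis by (simp add: op_rep_projector[OF h(1)] c projector_smult)
  qed
  moreover have "berezin p A (act g x0) = op_trace (idx p) (mm (idx p) A (op_rep p g (projector p e1)))"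
    if "g \<in> SU3" for A g
    using that by (simp add: x0_def act_proj op_rep_projector berezin_unit SU3_norm flip: qform_projector)
  ultimately show ?thesis by (simp add: operator_kernel_def projector_in_ops)
qed

section \<open>Uniqueness of the operator kernel\<close>

lemma trace_op_unit:
  assumes "a \<in> idx p" "b \<in> idx p"
  shows "op_trace (idx p) (mm (idx p) (op_unit (a, b)) K) = K (b, a)"
proof -
  have "op_trace (idx p) (mm (idx p) (op_unit (a, b)) K)
      = (\<Sum>t\<in>idx p \<times> idx p. op_unit (a, b) t * K (snd t, fst t))"
    by (simp add: op_trace_def mm_def sum.cartesian_product split_beta)
  also have "\<dots> = (\<Sum>t\<in>idx p \<times> idx p. if t = (a, b) then K (b, a) else 0)"
    by (intro sum.cong) (auto simp: op_unit_def)
  finally have "op_trace (idx p) (mm (idx p) (op_unit (a, b)) K)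
      = (\<Sum>t\<in>idx p \<times> idx p. if t = (a, b) then K (b, a) else 0)" .
  then show ?thesis using assms by simp
qed

text \<open>At the identity of the group the kernel property prescribes the trace of A K for all A,
  and matrix units A read off the entries of K.\<close>

lemma operator_kernel_unique:
  assumes K: "operator_kernel p W K" and K': "operator_kernel p W K'"
  shows "K = K'"
proof -
  have "cadj (mat 1) = mat 1" by (simp add: cadj_def mat_def vec_eq_iff)
  then have one: "mat 1 \<in> SU3" by (simp add: SU3_def)
  \<comment> \<open>Isotropy invariance at the identity gives \<open>op_rep p (mat 1) K = K\<close>
    directly from the definition of a kernel.\<close>
  then have one': "mat 1 \<in> isotropy" by (simp add: isotropy_def x0_def act_proj)
  have "K (b, a) = K' (b, a)" if "a \<in> idx p" "b \<in> idx p" for a b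
  proof -
    have "op_unit (a, b) \<in> ops p" using that by (auto simp: cspace_def op_unit_def)
    then show ?thesis
      using K K' one one' unfolding operator_kernel_def by (metis that trace_op_unit)
  qed
  then have "K i = K' i" for i
    using K K' by (cases i; cases "i \<in> idx p \<times> idx p") (auto simp: operator_kernel_def cspace_def)
  then show ?thesis by auto
qed

section \<open>The action of the Lie algebra\<close>

definition mat_pow :: "complex^3^3 \<Rightarrow> nat \<Rightarrow> complex^3^3" where
  "mat_pow X k = (((**) X ^^ k) (mat 1))"

lemma mat_pow_0 [simp]: "mat_pow X 0 = mat 1"
  and mat_pow_Suc: "mat_pow X (Suc k) = X ** mat_pow X k"
  by (simp_all add: mat_pow_def)

lemma mat_pow_Suc2: "mat_pow X (Suc k) = mat_pow X k ** X"
proof (induction k)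
  case (Suc k)
  then show ?case by (metis mat_pow_Suc matrix_mul_assoc)
qed (simp add: mat_pow_Suc)

lemma mat_pow_scale: "mat_pow (t *\<^sub>R X) k $ i $ j = of_real (t ^ k) * mat_pow X k $ i $ j"
proof (induction k arbitrary: i j)
  case (Suc k)
  show ?case
    unfolding mat_pow_Suc matrix_matrix_mult_def
    by (simp add: Suc sum_distrib_left scaleR_conv_of_real[where 'a = complex] mult_ac)
qed (simp add: mat_def)

text \<open>The sum of the moduli of all entries is a submultiplicative norm. The bound compares the
  entries of the exponential with a scalar exponential series.\<close>

lemma cmod_mat_pow_le: "cmod (mat_pow X k $ i $ j) \<le> (\<Sum>i\<in>UNIV. \<Sum>j\<in>UNIV. cmod (X $ i $ j)) ^ k"
proof (induction k arbitrary: i j)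
  case (Suc k)
  define B where "B = (\<Sum>i\<in>UNIV. \<Sum>j\<in>UNIV. cmod (X $ i $ j))"
  have "cmod (mat_pow X (Suc k) $ i $ j) \<le> (\<Sum>l\<in>UNIV. cmod (X $ i $ l) * cmod (mat_pow X k $ l $ j))"
    unfolding mat_pow_Suc matrix_matrix_mult_def
    by (simp add: norm_mult order_trans[OF norm_sum])
  also have "\<dots> \<le> (\<Sum>l\<in>UNIV. cmod (X $ i $ l) * B ^ k)"
    using Suc by (intro sum_mono mult_left_mono) (auto simp: B_def)
  also have "\<dots> = (\<Sum>l\<in>UNIV. cmod (X $ i $ l)) * B ^ k"
    by (simp add: sum_distrib_right)
  also have "\<dots> \<le> B * B ^ k"
    unfolding B_def
    by (intro mult_right_mono member_le_sum[where f = "\<lambda>i. \<Sum>l\<in>UNIV. cmod (X $ i $ l)"] zero_le_power sum_nonneg) auto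
  finally show ?case by (simp add: B_def)
qed (simp add: mat_def)

definition exp_coeff :: "complex^3^3 \<Rightarrow> 3 \<Rightarrow> 3 \<Rightarrow> nat \<Rightarrow> complex" where
  "exp_coeff X i j k = mat_pow X k $ i $ j / fact k"

text \<open>The parameter is complex so that termwise differentiation of power series applies;
  \<open>mat_exp_entry\<close> specialises it to real times.\<close>

definition exp_entry :: "complex^3^3 \<Rightarrow> 3 \<Rightarrow> 3 \<Rightarrow> complex \<Rightarrow> complex" where
  "exp_entry X i j s = (\<Sum>k. exp_coeff X i j k * s ^ k)"

lemma summable_exp_coeff: "summable (\<lambda>k. exp_coeff X i j k * s ^ k)"
proof (rule summable_comparison_test')
  define B where "B = (\<Sum>i\<in>UNIV. \<Sum>j\<in>UNIV. cmod (X $ i $ j))"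
  show "summable (\<lambda>k. inverse (fact k) * (B * cmod s) ^ k)" by (rule summable_exp)
  show "norm (exp_coeff X i j k * s ^ k) \<le> inverse (fact k) * (B * cmod s) ^ k" for k
    using mult_right_mono[OF cmod_mat_pow_le[of X k i j], of "cmod s ^ k / fact k"]
    by (simp add: exp_coeff_def norm_mult norm_divide norm_power power_mult_distrib B_def norm_inverse norm_fact
        divide_inverse mult_ac)
qed

lemma mat_exp_entry: "mat_exp (t *\<^sub>R X) $ i $ j = exp_entry X i j (of_real t)"
proof -
  define f where "f k = (1 / fact k) *\<^sub>R mat_pow (t *\<^sub>R X) k" for k
  have f: "f k $ i $ j = exp_coeff X i j k * of_real t ^ k" for i j k
    by (simp add: f_def mat_pow_scale exp_coeff_def scaleR_conv_of_real[where 'a = complex])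
  have "f sums (\<chi> i j. exp_entry X i j (of_real t))"
    unfolding sums_def
  proof (intro vec_tendstoI)
    fix i j
    have "(\<lambda>k. f k $ i $ j) sums exp_entry X i j (of_real t)"
      unfolding f exp_entry_def by (rule summable_sums[OF summable_exp_coeff])
    then show "(\<lambda>n. sum f {..<n} $ i $ j) \<longlonglongrightarrow> (\<chi> i j. exp_entry X i j (of_real t)) $ i $ j"
      by (simp add: sums_def)
  qed
  then show ?thesis
    unfolding mat_exp_def mat_pow_def[symmetric] f_def[symmetric] by (simp add: sums_unique[symmetric])
qed

lemma exp_entry_0: "exp_entry X i j 0 = mat 1 $ i $ j"
  unfolding exp_entry_def powser_zero by (simp add: exp_coeff_def)

lemma diffs_exp_coeff: "diffs (exp_coeff X i j) k = mat_pow X (Suc k) $ i $ j / fact k"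
  by (simp add: diffs_def exp_coeff_def del: of_nat_Suc)

text \<open>The derivative of exp(sX) is X exp(sX), and in the companion lemma exp(sX) X. Both forms
  are wanted: differentiating exp(sX) exp(-sX) with X on the inner side of each factor makes the two
  terms cancel.\<close>

lemma exp_entry_sum_left:
  "(\<Sum>k. diffs (exp_coeff X i j) k * s ^ k) = (\<Sum>l\<in>UNIV. X $ i $ l * exp_entry X l j s)"
proof -
  have "diffs (exp_coeff X i j) k * s ^ k = (\<Sum>l\<in>UNIV. X $ i $ l * (exp_coeff X l j k * s ^ k))" for k
    unfolding diffs_exp_coeff exp_coeff_def mat_pow_Suc matrix_matrix_mult_def
    by (simp add: sum_distrib_right sum_distrib_left divide_inverse mult_ac)
  then show ?thesis
    by (simp add: exp_entry_def suminf_sum suminf_mult summable_exp_coeff summable_mult)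
qed

lemma exp_entry_sum_right:
  "(\<Sum>k. diffs (exp_coeff X i j) k * s ^ k) = (\<Sum>l\<in>UNIV. exp_entry X i l s * X $ l $ j)"
proof -
  have "diffs (exp_coeff X i j) k * s ^ k = (\<Sum>l\<in>UNIV. (exp_coeff X i l k * s ^ k) * X $ l $ j)" for k
    unfolding diffs_exp_coeff exp_coeff_def mat_pow_Suc2 matrix_matrix_mult_def
    by (simp add: sum_distrib_right sum_distrib_left divide_inverse mult_ac)
  then show ?thesis
    by (simp add: exp_entry_def suminf_sum suminf_mult2[symmetric] summable_exp_coeff summable_mult2)
qed

lemma exp_entry_deriv:
  "(exp_entry X i j has_field_derivative (\<Sum>k. diffs (exp_coeff X i j) k * s ^ k)) (at s)"
  unfolding exp_entry_def by (rule termdiffs_strong_converges_everywhere[OF summable_exp_coeff])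

text \<open>The product has derivative zero in s, hence equals its value at s = 0.\<close>

lemma exp_entry_inverse: "(\<Sum>l\<in>UNIV. exp_entry X i l s * exp_entry X l j (- s)) = mat 1 $ i $ j"
proof -
  define G where "G s = (\<Sum>l\<in>UNIV. exp_entry X i l s * exp_entry X l j (- s))" for s
  have "(G has_field_derivative 0) (at s)" for s
  proof -
    have 1: "(exp_entry X i l has_field_derivative (\<Sum>m\<in>UNIV. exp_entry X i m s * X $ m $ l)) (at s)" for l
      using exp_entry_deriv[of X i l s] unfolding exp_entry_sum_right .
    have 2: "((\<lambda>s. exp_entry X l j (- s)) has_field_derivative
        (\<Sum>m\<in>UNIV. X $ l $ m * exp_entry X m j (- s)) * (- 1)) (at s)" for l
      by (rule DERIV_chain2[where f = "exp_entry X l j"])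
        (use exp_entry_deriv[of X l j "- s"] in \<open>auto simp: exp_entry_sum_left intro!: derivative_eq_intros\<close>)
    have "(G has_field_derivative (\<Sum>l\<in>UNIV. (\<Sum>m\<in>UNIV. exp_entry X i m s * X $ m $ l) * exp_entry X l j (- s)
        + (\<Sum>m\<in>UNIV. X $ l $ m * exp_entry X m j (- s)) * (- 1) * exp_entry X i l s)) (at s)"
      unfolding G_def by (intro DERIV_sum DERIV_mult 1 2)
    also have "(\<Sum>l\<in>UNIV. (\<Sum>m\<in>UNIV. exp_entry X i m s * X $ m $ l) * exp_entry X l j (- s)
        + (\<Sum>m\<in>UNIV. X $ l $ m * exp_entry X m j (- s)) * (- 1) * exp_entry X i l s) = 0"
      by (simp add: sum_3 algebra_simps)
    finally show ?thesis .
  qed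
  then have "\<exists>c. \<forall>s\<in>UNIV. G s = c"
    by (intro has_field_derivative_zero_constant) auto
  then have "G s = G 0" by auto
  also have "\<dots> = mat 1 $ i $ j"
    using exhaust_3[of i] exhaust_3[of j] by (auto simp: G_def exp_entry_0 mat_def sum_3)
  finally show ?thesis by (simp add: G_def)
qed

lemma mat_exp_inverse: "mat_exp (t *\<^sub>R X) ** mat_exp (t *\<^sub>R (- X)) = mat 1"
proof -
  have "mat_exp (t *\<^sub>R (- X)) = mat_exp ((- t) *\<^sub>R X)" by simp
  then show ?thesis
    by (simp only: vec_eq_iff matrix_matrix_mult_def vec_lambda_beta mat_exp_entry of_real_minus
        exp_entry_inverse simp_thms)
qed

lemma matrix_inv_mat_exp: "matrix_inv (mat_exp (t *\<^sub>R X)) = mat_exp (t *\<^sub>R (- X))"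
  by (rule matrix_inv_unique[OF mat_exp_inverse])

lemma mat_exp_0: "mat_exp (0 *\<^sub>R X) = mat 1"
  unfolding vec_eq_iff mat_exp_entry of_real_0 exp_entry_0 by simp

lemma mat_exp_deriv: "((\<lambda>t. mat_exp (t *\<^sub>R X) $ i $ j) has_vector_derivative X $ i $ j) (at 0)"
proof -
  have "(\<Sum>l\<in>UNIV. exp_entry X i l 0 * X $ l $ j) = X $ i $ j"
    using exhaust_3[of i] by (auto simp: exp_entry_0 mat_def sum_3)
  then have "(exp_entry X i j has_field_derivative X $ i $ j) (at (of_real 0))"
    using exp_entry_deriv[of X i j 0] unfolding exp_entry_sum_right by simp
  then show ?thesis
    unfolding mat_exp_entry by (rule has_vector_derivative_real_field)
qed

section \<open>Differentials of the two representations\<close>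

definition dword :: "nat \<Rightarrow> complex^3^3 \<Rightarrow> 3 list \<Rightarrow> 3 list \<Rightarrow> complex" where
  "dword p X w w' = (\<Sum>i<p. X $ (w ! i) $ (w' ! i) * (\<Prod>j\<in>{..<p} - {i}. mat 1 $ (w ! j) $ (w' ! j)))"

text \<open>\<open>dword\<close> holds the word entries of the sum of all 1 x ... x X x ... x 1, the
  Leibniz derivative of the tensor power at the identity. Compressed to symmetric tensors this is
  the differential of the representation, and it makes sense for every complex matrix X.\<close>

definition dsym :: "nat \<Rightarrow> complex^3^3 \<Rightarrow> (midx \<times> midx) cvec" where
  "dsym p X = (\<lambda>(a, b). if a \<in> idx p \<and> b \<in> idx p
     then \<Sum>w\<in>words p. \<Sum>w'\<in>words p. cnj (sym_vec a w) * (dword p X w w' * sym_vec b w') else 0)"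

lemma sym_rep_deriv:
  "((\<lambda>t. sym_rep p (mat_exp (t *\<^sub>R X)) ab) has_vector_derivative dsym p X ab) (at 0)"
proof -
  obtain a b where ab: "ab = (a, b)" by (cases ab)
  define M where "M t = mat_exp (t *\<^sub>R X)" for t
  have M0: "M 0 = mat 1" using mat_exp_0[of X] by (simp add: M_def)
  have "((\<lambda>t. \<Prod>i<p. M t $ (w ! i) $ (w' ! i)) has_vector_derivative dword p X w w') (at 0)" for w w'
  proof -
    have "((\<lambda>t. \<Prod>i<p. M t $ (w ! i) $ (w' ! i)) has_derivative
      (\<lambda>h. \<Sum>i<p. (h *\<^sub>R X $ (w ! i) $ (w' ! i)) * (\<Prod>j\<in>{..<p} - {i}. M 0 $ (w ! j) $ (w' ! j)))) (at 0)"
      using mat_exp_deriv[of X] unfolding has_vector_derivative_def M_def by (intro has_derivative_prod)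
    then show ?thesis
      by (simp add: has_vector_derivative_def dword_def M0 scaleR_sum_right)
  qed
  then have "((\<lambda>t. \<Sum>w\<in>words p. \<Sum>w'\<in>words p.
      cnj (sym_vec a w) * ((\<Prod>i<p. M t $ (w ! i) $ (w' ! i)) * sym_vec b w')) has_vector_derivative
      (\<Sum>w\<in>words p. \<Sum>w'\<in>words p. cnj (sym_vec a w) * (dword p X w w' * sym_vec b w'))) (at 0)"
    by (intro has_vector_derivative_sum has_vector_derivative_mult_right has_vector_derivative_mult_left)
  moreover have "sym_rep p (M t) ab = (if a \<in> idx p \<and> b \<in> idx p then \<Sum>w\<in>words p. \<Sum>w'\<in>words p.
      cnj (sym_vec a w) * ((\<Prod>i<p. M t $ (w ! i) $ (w' ! i)) * sym_vec b w') else 0)" for t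
    by (simp add: ab sym_rep_def cip_def tensor_power_def sum_distrib_left)
  ultimately show ?thesis
    unfolding M_def[symmetric] by (cases "a \<in> idx p \<and> b \<in> idx p") (auto simp: ab dsym_def)
qed

lemma dsym_complex_linear:
  assumes "\<And>i j. X $ i $ j = A $ i $ j + \<i> * B $ i $ j"
  shows "dsym p X ab = dsym p A ab + \<i> * dsym p B ab"
proof -
  have "dword p X w w' = dword p A w w' + \<i> * dword p B w w'" for w w'
    by (simp add: dword_def assms distrib_right sum.distrib sum_distrib_left mult.assoc)
  then show ?thesis
    by (cases ab) (simp add: dsym_def distrib_left distrib_right sum.distrib sum_distrib_left mult_ac)
qed

lemma dsym_uminus: "dsym p (- X) ab = - dsym p X ab"
  by (cases ab) (simp add: dsym_def dword_def sum_negf)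

lemma skew_parts:
  "X $ j $ k = (\<chi> j k. (X $ j $ k - cnj (X $ k $ j)) / 2) $ j $ k
    + \<i> * (\<chi> j k. (X $ j $ k + cnj (X $ k $ j)) / (2 * \<i>)) $ j $ k"
  by (simp add: field_simps)

text \<open>\<open>dsym\<close> computes the derivative along each skew-Hermitian part and is
  complex linear in X, so the splitting built into \<open>lie\<close> recombines.\<close>

lemma lie_vec_rep: "lie (vec_rep p) X v = mv (idx p) (dsym p X) v"
proof
  fix a
  have "lie_real (vec_rep p) Y v a = mv (idx p) (dsym p Y) v a" for Y
    unfolding lie_real_def vec_rep_def mv_def
    by (intro vector_derivative_at has_vector_derivative_sum has_vector_derivative_mult_left sym_rep_deriv)
  then show "lie (vec_rep p) X v a = mv (idx p) (dsym p X) v a"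
    unfolding lie_def
    by (simp add: mv_def dsym_complex_linear[OF skew_parts[of X]] sum_distrib_left distrib_left distrib_right sum.distrib mult_ac)
qed

lemma words_neq_nth:
  assumes "w \<in> words p" "w' \<in> words p" "w \<noteq> w'"
  obtains i where "i < p" "w ! i \<noteq> w' ! i"
  using assms nth_equalityI[of w w'] by (auto simp: words_def)

lemma tensor_power_one: "w \<in> words p \<Longrightarrow> tensor_power p (mat 1) x w = x w"
proof -
  assume w: "w \<in> words p"
  have "(\<Prod>i<p. mat 1 $ (w ! i) $ (w' ! i) :: complex) = (if w' = w then 1 else 0)"
    if w': "w' \<in> words p" for w'
  proof (cases "w' = w")
    case False
    then obtain i where "i < p" "w ! i \<noteq> w' ! i"
      using words_neq_nth[OF w w'] by metis
    then show ?thesis using False by (auto simp: mat_def)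
  qed (simp add: mat_def)
  note delta = this
  have "tensor_power p (mat 1) x w = (\<Sum>w'\<in>words p. (\<Prod>i<p. mat 1 $ (w ! i) $ (w' ! i)) * x w')"
    using w by (simp add: tensor_power_def)
  also have "\<dots> = (\<Sum>w'\<in>words p. if w' = w then x w else 0)"
    by (intro sum.cong refl) (simp add: delta)
  finally have "tensor_power p (mat 1) x w = (\<Sum>w'\<in>words p. if w' = w then x w else 0)" .
  then show ?thesis using w by simp
qed

lemma sym_rep_one: "sym_rep p (mat 1) = op_id (idx p)"
proof -
  have "cip (words p) u (tensor_power p (mat 1) v) = cip (words p) u v" for u v
    by (simp add: cip_def tensor_power_one)
  then show ?thesis
    by (auto simp: fun_eq_iff sym_rep_def op_id_def sym_vec_orthonormal)
qed

lemma ops_zero: "A \<in> ops p \<Longrightarrow> a \<notin> idx p \<or> b \<notin> idx p \<Longrightarrow> A (a, b) = 0"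
  unfolding cspace_def by blast

lemma mm_op_id:
  assumes "A \<in> ops p"
  shows "mm (idx p) (op_id (idx p)) A = A" "mm (idx p) A (op_id (idx p)) = A"
proof -
  note z = ops_zero[OF assms]
  have "mm (idx p) (op_id (idx p)) A (a, c) = (\<Sum>b\<in>idx p. if b = a then A (a, c) else 0)" for a c
    unfolding mm_def op_id_def prod.case by (intro sum.cong refl) auto
  then show "mm (idx p) (op_id (idx p)) A = A" by (auto simp: fun_eq_iff z)
  have "mm (idx p) A (op_id (idx p)) (a, c) = (\<Sum>b\<in>idx p. if b = c then A (a, c) else 0)" for a c
    unfolding mm_def op_id_def prod.case by (intro sum.cong refl) auto
  then show "mm (idx p) A (op_id (idx p)) = A" by (auto simp: fun_eq_iff z)
qed

definition op_comm :: "nat \<Rightarrow> complex^3^3 \<Rightarrow> (midx \<times> midx) cvec \<Rightarrow> (midx \<times> midx) cvec" where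
  "op_comm p X A = (\<lambda>i. mm (idx p) (dsym p X) A i - mm (idx p) A (dsym p X) i)"

lemma mm_deriv:
  assumes "\<And>i. ((\<lambda>t. A t i) has_vector_derivative A' i) (at x)"
    and "\<And>i. ((\<lambda>t. B t i) has_vector_derivative B' i) (at x)"
  shows "((\<lambda>t. mm I (A t) (B t) i) has_vector_derivative (mm I (A x) B' i + mm I A' (B x) i)) (at x)"
proof -
  obtain a c where i: "i = (a, c)" by (cases i)
  have "((\<lambda>t. \<Sum>b\<in>I. A t (a, b) * B t (b, c)) has_vector_derivative
      (\<Sum>b\<in>I. A x (a, b) * B' (b, c) + A' (a, b) * B x (b, c))) (at x)"
    by (intro has_vector_derivative_sum has_vector_derivative_mult assms)
  then show ?thesis by (simp add: i mm_def sum.distrib)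
qed

text \<open>Product rule at t = 0, where \<open>sym_rep\<close> is the identity. The inverse is the
  exponential of the negated matrix, which produces the minus sign of the commutator.\<close>

lemma lie_op_rep:
  assumes A: "A \<in> ops p"
  shows "lie (op_rep p) X A = op_comm p X A"
proof
  fix i
  have "lie_real (op_rep p) Y A i = op_comm p Y A i" for Y
  proof -
    have inner: "((\<lambda>t. mm (idx p) A (sym_rep p (matrix_inv (mat_exp (t *\<^sub>R Y)))) i) has_vector_derivative
        - mm (idx p) A (dsym p Y) i) (at 0)" for i
      using mm_deriv[where A = "\<lambda>_. A" and I = "idx p" and i = i,
          OF has_vector_derivative_const sym_rep_deriv[of p "- Y"]]
      by (cases i) (simp add: matrix_inv_mat_exp mm_def dsym_uminus sum_negf)
    have "((\<lambda>t. op_rep p (mat_exp (t *\<^sub>R Y)) A i) has_vector_derivative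
        (mm (idx p) (sym_rep p (mat_exp (0 *\<^sub>R Y))) (\<lambda>i. - mm (idx p) A (dsym p Y) i) i
        + mm (idx p) (dsym p Y) (mm (idx p) A (sym_rep p (matrix_inv (mat_exp (0 *\<^sub>R Y))))) i)) (at 0)"
      unfolding op_rep_def by (rule mm_deriv[OF sym_rep_deriv inner])
    moreover have "(\<lambda>i. - mm (idx p) A (dsym p Y) i) \<in> ops p"
      unfolding cspace_def by (auto simp: mm_def dsym_def ops_zero[OF A])
    moreover have "matrix_inv (mat 1 :: complex^3^3) = mat 1" by (rule matrix_inv_unique) simp
    ultimately have "((\<lambda>t. op_rep p (mat_exp (t *\<^sub>R Y)) A i) has_vector_derivative op_comm p Y A i) (at 0)"
      unfolding mat_exp_0 by (simp add: sym_rep_one mm_op_id A op_comm_def)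
    then show ?thesis
      unfolding lie_real_def by (rule vector_derivative_at)
  qed
  then show "lie (op_rep p) X A i = op_comm p X A i"
    unfolding lie_def
    by (cases i) (simp add: op_comm_def mm_def dsym_complex_linear[OF skew_parts[of X]] sum_distrib_left
        distrib_right distrib_left sum.distrib right_diff_distrib mult_ac)
qed

section \<open>The highest weight space of (p,0)\<close>

lemma letter_count_top:
  assumes "w \<in> words p" "letter_count w = (p, 0, 0)" "i < p"
  shows "w ! i = 1"
proof -
  have "2 \<notin> set w" "3 \<notin> set w" using assms(2) by (auto simp: letter_count_def count_list_0_iff)
  moreover have "w ! i \<in> set w" using assms(1,3) by (auto simp: words_def)
  ultimately show ?thesis using exhaust_3[of "w ! i"] by auto
qed

text \<open>The top index belongs to the single word 1...1, so each Leibniz term contains an entry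
  from the first column of X.\<close>

lemma dsym_top_col:
  assumes "\<And>i. X $ i $ 1 = 0"
  shows "dsym p X (a, (p, 0, 0)) = 0"
proof -
  have "dword p X w w' = 0" if "w' \<in> words p" "letter_count w' = (p, 0, 0)" for w w'
    unfolding dword_def using letter_count_top[OF that] by (intro sum.neutral) (auto simp: assms)
  moreover have "(p, 0, 0) \<in> idx p" by (simp add: idx_def)
  ultimately show ?thesis
    by (auto simp: dsym_def sym_vec_eq[OF \<open>(p, 0, 0) \<in> idx p\<close>] intro!: sum.neutral)
qed

lemma dsym_top_row:
  assumes "\<And>j. X $ 1 $ j = 0"
  shows "dsym p X ((p, 0, 0), b) = 0"
proof -
  have "dword p X w w' = 0" if "w \<in> words p" "letter_count w = (p, 0, 0)" for w w'
    unfolding dword_def using letter_count_top[OF that] by (intro sum.neutral) (auto simp: assms)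
  moreover have "(p, 0, 0) \<in> idx p" by (simp add: idx_def)
  ultimately show ?thesis
    by (auto simp: dsym_def sym_vec_eq[OF \<open>(p, 0, 0) \<in> idx p\<close>] intro!: sum.neutral)
qed

definition weight_eval :: "complex^3^3 \<Rightarrow> midx \<Rightarrow> complex" where
  "weight_eval X = (\<lambda>(j, k, l). of_nat j * X $ 1 $ 1 + of_nat k * X $ 2 $ 2 + of_nat l * X $ 3 $ 3)"

lemma weight_eval_letter_count: "weight_eval X (letter_count w) = (\<Sum>i<length w. X $ (w ! i) $ (w ! i))"
proof (induction w)
  case (Cons c w)
  then show ?case
    using exhaust_3[of c]
    by (auto simp: weight_eval_def letter_count_def sum.lessThan_Suc_shift algebra_simps simp del: sum.lessThan_Suc)
qed (simp add: weight_eval_def letter_count_def)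

lemma dword_diag:
  assumes "\<And>i j. i \<noteq> j \<Longrightarrow> X $ i $ j = 0" and w: "w \<in> words p" and w': "w' \<in> words p"
  shows "dword p X w w' = (if w = w' then weight_eval X (letter_count w) else 0)"
proof (cases "w = w'")
  case True
  then show ?thesis
    using w by (simp add: dword_def mat_def weight_eval_letter_count words_def)
next
  case False
  then obtain k where k: "k < p" "w ! k \<noteq> w' ! k"
    using words_neq_nth[OF w w'] by metis
  \<comment> \<open>At the position \<open>k\<close> where the words differ, either the identity
    factor vanishes or, if \<open>i = k\<close>, the off-diagonal entry of X does.\<close>
  have "X $ (w ! i) $ (w' ! i) * (\<Prod>j\<in>{..<p} - {i}. mat 1 $ (w ! j) $ (w' ! j)) = 0" for i
  proof (cases "i = k")
    case False
    with k have "(\<Prod>j\<in>{..<p} - {i}. mat 1 $ (w ! j) $ (w' ! j) :: complex) = 0"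
      by (intro prod_zero bexI[of _ k]) (auto simp: mat_def)
    then show ?thesis by simp
  qed (use k assms(1) in simp)
  then have "dword p X w w' = 0" unfolding dword_def by (intro sum.neutral) blast
  then show ?thesis using False by simp
qed

lemma mv_dsym_diag:
  assumes "\<And>i j. i \<noteq> j \<Longrightarrow> X $ i $ j = 0" and "a \<in> idx p"
  shows "mv (idx p) (dsym p X) v a = weight_eval X a * v a"
proof -
  have "dsym p X (a, b) = (if b = a then weight_eval X a else 0)" if "b \<in> idx p" for b
  proof -
    have "dsym p X (a, b) = (\<Sum>w\<in>words p. \<Sum>w'\<in>words p. cnj (sym_vec a w) * (dword p X w w' * sym_vec b w'))"
      by (simp add: dsym_def assms(2) that)
    also have "\<dots> = (\<Sum>w\<in>words p. \<Sum>w'\<in>words p.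
        if w' = w then cnj (sym_vec a w) * (weight_eval X (letter_count w) * sym_vec b w) else 0)"
      by (intro sum.cong refl) (auto simp: dword_diag[OF assms(1)])
    also have "\<dots> = (\<Sum>w\<in>words p. cnj (sym_vec a w) * (weight_eval X (letter_count w) * sym_vec b w))"
      by (intro sum.cong refl) simp
    also have "\<dots> = weight_eval X a * cip (words p) (sym_vec a) (sym_vec b)"
      unfolding cip_def sum_distrib_left
      by (intro sum.cong refl) (auto simp: sym_vec_eq[OF assms(2)])
    finally show ?thesis using sym_vec_orthonormal[OF assms(2) that] by auto
  qed
  then have "mv (idx p) (dsym p X) v a = (\<Sum>b\<in>idx p. if b = a then weight_eval X a * v a else 0)"
    unfolding mv_def by (intro sum.cong refl) auto
  then show ?thesis using assms(2) by simp
qed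

lemma Phi_e1: "Phi p e1 a = (if a = (p, 0, 0) then 1 else 0)"
  by (auto simp: Phi_eq mpower_def idx_def multinom_def power_0_left split: if_splits)

lemma mv_top: "mv (idx p) A (\<lambda>i. c * Phi p e1 i) a = A (a, (p, 0, 0)) * c"
proof -
  have "mv (idx p) A (\<lambda>i. c * Phi p e1 i) a = (\<Sum>b\<in>idx p. if b = (p, 0, 0) then A (a, (p, 0, 0)) * c else 0)"
    unfolding mv_def by (intro sum.cong refl) (auto simp: Phi_e1)
  moreover have "(p, 0, 0) \<in> idx p" by (simp add: idx_def)
  ultimately show ?thesis by simp
qed

lemma highest_weight_space_vec_rep:
  "highest_weight_space (vec_rep p) (cspace (idx p)) p 0 = {v. \<exists>c. v = (\<lambda>i. c * Phi p e1 i)}"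
proof (intro equalityI subsetI)
  fix v assume v: "v \<in> highest_weight_space (vec_rep p) (cspace (idx p)) p 0"
  define X :: "complex^3^3" where "X = (1/2) *\<^sub>R (Emat 1 1 - Emat 2 2)"
  have X: "X $ i $ j = 0" if "i \<noteq> j" for i j using that by (auto simp: X_def Emat_def)
  have v0: "v a = 0" if "a \<notin> idx p" for a 
    using v that unfolding highest_weight_space_def cspace_def by blast
  have T: "mv (idx p) (dsym p X) v a = of_real (real p / 2) * v a" for a
    using v by (auto simp: highest_weight_space_def T_3_def lie_vec_rep X_def[symmetric] dest: fun_cong)
  have "v a = 0" if "a \<noteq> (p, 0, 0)" for a
  proof (cases "a \<in> idx p")
    case True
    obtain j k l where a: "a = (j, k, l)" by (cases a)
    \<comment> \<open>With j + k + l = p, the eigenvalue (j - k)/2 of \<open>T_3\<close> reaches p/2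
      only at (p,0,0).\<close>
    have "weight_eval X a = of_real ((real j - real k) / 2)"
      by (simp add: weight_eval_def a X_def Emat_def scaleR_conv_of_real[where 'a = complex] field_simps)
    moreover have "(real j - real k) / 2 \<noteq> real p / 2" using True that by (auto simp: a idx_def)
    ultimately show ?thesis
      using T[of a] mv_dsym_diag[OF X True, of v] by (metis mult_right_cancel of_real_eq_iff)
  qed (rule v0)
  then have "v = (\<lambda>i. v (p, 0, 0) * Phi p e1 i)" by (auto simp: fun_eq_iff Phi_e1)
  then show "v \<in> {v. \<exists>c. v = (\<lambda>i. c * Phi p e1 i)}" by blast
next
  fix v assume "v \<in> {v. \<exists>c. v = (\<lambda>i. c * Phi p e1 i)}"
  then obtain c where v: "v = (\<lambda>i. c * Phi p e1 i)" by blast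
  have top: "(p, 0, 0) \<in> idx p" by (simp add: idx_def)
  have diag: "mv (idx p) (dsym p X) v = (\<lambda>i. weight_eval X (p, 0, 0) * v i)"
    if X: "\<And>i j. i \<noteq> j \<Longrightarrow> X $ i $ j = 0" for X
  proof
    fix a
    show "mv (idx p) (dsym p X) v a = weight_eval X (p, 0, 0) * v a"
    proof (cases "a \<in> idx p")
      case True
      then have "mv (idx p) (dsym p X) v a = weight_eval X a * v a" by (intro mv_dsym_diag X True)
      then show ?thesis by (cases "a = (p, 0, 0)") (simp_all add: v Phi_e1)
    next
      case False
      then have "v a = 0" "mv (idx p) (dsym p X) v a = 0"
        by (simp_all add: v Phi_eq mv_def dsym_def)
      then show ?thesis by simp
    qed
  qed
  \<comment> \<open>Both raising matrices \<open>Emat 1 2\<close> and \<open>Emat 2 3\<close> have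
    zero first column.\<close>
  have nil: "mv (idx p) (dsym p X) v = (\<lambda>_. 0)" if "\<And>i. X $ i $ 1 = 0" for X
    by (auto simp: fun_eq_iff v mv_top dsym_top_col[OF that])
  have "mv (idx p) (dsym p ((1/2) *\<^sub>R (Emat 1 1 - Emat 2 2))) v = (\<lambda>i. of_real (real p / 2) * v i)"
    by (subst diag) (auto simp: Emat_def weight_eval_def scaleR_conv_of_real[where 'a = complex])
  moreover have "mv (idx p) (dsym p ((1/2) *\<^sub>R (Emat 2 2 - Emat 3 3))) v = (\<lambda>i. of_real (real 0 / 2) * v i)"
    by (subst diag) (auto simp: Emat_def weight_eval_def)
  moreover have "mv (idx p) (dsym p (Emat 1 2)) v = (\<lambda>_. 0)" "mv (idx p) (dsym p (Emat 2 3)) v = (\<lambda>_. 0)"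
    by (rule nil; simp add: Emat_def)+
  moreover have "v \<in> cspace (idx p)" by (simp add: v cspace_def Phi_eq)
  ultimately show "v \<in> highest_weight_space (vec_rep p) (cspace (idx p)) p 0"
    unfolding highest_weight_space_def T_plus_def U_plus_def T_3_def U_3_def lie_vec_rep by blast
qed

text \<open>The two projection conditions determine the image of every vector, and testing on unit
  coordinate vectors determines the matrix; outside \<open>idx p\<close> both matrices vanish by
  membership in \<open>ops p\<close>.\<close>

lemma projector_eq_orth_projection:
  "projector p e1 = orth_projection (idx p) (highest_weight_space (vec_rep p) (cspace (idx p)) p 0)"
  unfolding orth_projection_def highest_weight_space_vec_rep
proof (rule the_equality[symmetric])
  have top: "(p, 0, 0) \<in> idx p" by (simp add: idx_def)
  have c: "cip (idx p) (\<lambda>i. c * Phi p e1 i) v = cnj c * v (p, 0, 0)" for c v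
  proof -
    have "cip (idx p) (\<lambda>i. c * Phi p e1 i) v = (\<Sum>b\<in>idx p. if b = (p, 0, 0) then cnj c * v (p, 0, 0) else 0)"
      unfolding cip_def by (intro sum.cong refl) (auto simp: Phi_e1)
    then show ?thesis using top by simp
  qed
  have m: "mv (idx p) (projector p e1) v = (\<lambda>i. v (p, 0, 0) * Phi p e1 i)" for v
  proof
    fix a
    have "mv (idx p) (projector p e1) v a = (\<Sum>b\<in>idx p. if b = (p, 0, 0) then v (p, 0, 0) * Phi p e1 a else 0)"
      unfolding mv_def by (intro sum.cong refl) (auto simp: projector_e1 Phi_e1)
    then show "mv (idx p) (projector p e1) v a = v (p, 0, 0) * Phi p e1 a" using top by simp
  qed
  show "projector p e1 \<in> ops p \<and>
    (\<forall>v\<in>cspace (idx p). mv (idx p) (projector p e1) v \<in> {v. \<exists>c. v = (\<lambda>i. c * Phi p e1 i)} \<and>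
      (\<forall>w\<in>{v. \<exists>c. v = (\<lambda>i. c * Phi p e1 i)}. cip (idx p) w (\<lambda>i. v i - mv (idx p) (projector p e1) v i) = 0))"
    by (auto simp: projector_in_ops m c) (simp add: Phi_e1)
  fix P assume P: "P \<in> ops p \<and>
    (\<forall>v\<in>cspace (idx p). mv (idx p) P v \<in> {v. \<exists>c. v = (\<lambda>i. c * Phi p e1 i)} \<and>
      (\<forall>w\<in>{v. \<exists>c. v = (\<lambda>i. c * Phi p e1 i)}. cip (idx p) w (\<lambda>i. v i - mv (idx p) P v i) = 0))"
  have P_v: "mv (idx p) P v = (\<lambda>i. v (p, 0, 0) * Phi p e1 i)" if "v \<in> cspace (idx p)" for v
  proof -
    note Pv = bspec[OF conjunct2[OF P] that]
    obtain d where d: "mv (idx p) P v = (\<lambda>i. d * Phi p e1 i)" using conjunct1[OF Pv] by auto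
    \<comment> \<open>Orthogonality against the spanning vector itself determines the scalar
      \<open>d\<close>.\<close>
    have "cip (idx p) (\<lambda>i. 1 * Phi p e1 i) (\<lambda>i. v i - mv (idx p) P v i) = 0"
      by (rule bspec[OF conjunct2[OF Pv]], rule CollectI, rule exI, rule refl)
    then have "v (p, 0, 0) = d" unfolding c d by (simp add: Phi_e1)
    then show ?thesis using d by simp
  qed
  have "P (a, b) = projector p e1 (a, b)" if "b \<in> idx p" for a b
  proof -
    define v :: "midx cvec" where "v = (\<lambda>i. if i = b then 1 else 0)"
    have "v \<in> cspace (idx p)" using that by (auto simp: v_def cspace_def)
    then have "mv (idx p) P v a = mv (idx p) (projector p e1) v a" by (simp only: P_v m)
    moreover have "mv (idx p) A v a = A (a, b)" for A
    proof -
      have "mv (idx p) A v a = (\<Sum>c\<in>idx p. if c = b then A (a, b) else 0)"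
        unfolding mv_def by (intro sum.cong refl) (auto simp: v_def)
      then show ?thesis using that by simp
    qed
    ultimately show ?thesis by simp
  qed
  moreover have "P (a, b) = projector p e1 (a, b)" if "b \<notin> idx p" for a b
  proof -
    have "P \<in> ops p" by (rule conjunct1[OF P])
    then show ?thesis
      using that ops_zero[of P p a b] ops_zero[OF projector_in_ops, of a p b e1] by simp
  qed
  ultimately have "P i = projector p e1 i" for i by (cases i) metis
  then show "P = projector p e1" by (rule ext)
qed

section \<open>Decomposition of the kernel in the coupled basis\<close>

lemma finite_gt_labels: "finite (gt_labels p q)"
proof (rule finite_subset)
  show "gt_labels p q \<subseteq> (\<lambda>(rm, rp, \<nu>3). ((int p + 2 * int q - (rp + rm), rp + rm - \<nu>3, \<nu>3), real_of_int (rp - rm) / 2))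
      ` ({0..int q} \<times> {int q..int p + int q} \<times> {0..int p + int q})"
    by (auto simp: gt_labels_def image_iff) force
qed auto

lemma gt_labelsI:
  assumes "0 \<le> rm" "rm \<le> int q" "int q \<le> rp" "rp \<le> int p + int q" "rm \<le> \<nu>3" "\<nu>3 \<le> rp"
  shows "((int p + 2 * int q - (rp + rm), rp + rm - \<nu>3, \<nu>3), real_of_int (rp - rm) / 2) \<in> gt_labels p q"
  using assms unfolding gt_labels_def by blast

text \<open>In the parameters of a label, J + u is \<open>rp - \<nu>3\<close> and J - u is
  \<open>\<nu>3 - rm\<close>. On admissible labels the coefficient therefore vanishes exactly at
  \<open>\<nu>3 = rp\<close>.\<close>

lemma gt_U_coeff_label:
  "gt_U_coeff (\<nu>1, rp + rm - \<nu>3, \<nu>3) (real_of_int (rp - rm) / 2)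
    = sqrt (real_of_int (rp - \<nu>3) * real_of_int (\<nu>3 - rm + 1))"
proof -
  have "real_of_int (rp - rm) / 2 + real_of_int (rp + rm - \<nu>3 - \<nu>3) / 2 = real_of_int (rp - \<nu>3)"
    "real_of_int (rp - rm) / 2 - real_of_int (rp + rm - \<nu>3 - \<nu>3) / 2 + 1 = real_of_int (\<nu>3 - rm + 1)"
    by (simp_all add: field_simps)
  then show ?thesis unfolding gt_U_coeff_def Let_def prod.case by (simp only:)
qed

lemma gt_labels_middle: "((int n, int n, int n), 0) \<in> gt_labels n n"
  using gt_labelsI[of "int n" n "int n" n "int n"] by simp

section \<open>Coordinates in an orthonormal basis\<close>

lemma cip_sum_right: "cip I v (\<lambda>i. \<Sum>x\<in>L. c x * f x i) = (\<Sum>x\<in>L. c x * cip I v (f x))"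
proof -
  have "cip I v (\<lambda>i. \<Sum>x\<in>L. c x * f x i) = (\<Sum>i\<in>I. \<Sum>x\<in>L. c x * (cnj (v i) * f x i))"
    by (simp add: cip_def sum_distrib_left mult_ac)
  also have "\<dots> = (\<Sum>x\<in>L. \<Sum>i\<in>I. c x * (cnj (v i) * f x i))" by (rule sum.swap)
  finally show ?thesis by (simp add: cip_def sum_distrib_left)
qed

lemma orthonormal_basis_mem:
  assumes "orthonormal_basis I V L f" "finite L" "x \<in> L"
  shows "f x \<in> V"
proof -
  have "f x = (\<lambda>i. \<Sum>y\<in>L. (if y = x then 1 else 0) * f y i)"
  proof
    fix i
    have "(\<Sum>y\<in>L. (if y = x then 1 else 0) * f y i) = (\<Sum>y\<in>L. if y = x then f x i else 0)"
      by (intro sum.cong) auto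
    then show "f x i = (\<Sum>y\<in>L. (if y = x then 1 else 0) * f y i)" using assms by simp
  qed
  then have "f x \<in> cspan L f"
    unfolding cspan_def mem_Collect_eq by (intro exI[of _ "\<lambda>y. if y = x then 1 else 0"])
  then show ?thesis using assms(1) by (simp add: orthonormal_basis_def)
qed

lemma cip_orthonormal_sum:
  assumes "orthonormal_basis I V L f" "finite L" "L' \<subseteq> L" "y \<in> L'"
  shows "cip I (f y) (\<lambda>i. \<Sum>x\<in>L'. c x * f x i) = c y"
proof -
  have "(\<Sum>x\<in>L'. c x * cip I (f y) (f x)) = (\<Sum>x\<in>L'. if x = y then c y else 0)"
    using assms by (intro sum.cong) (auto simp: orthonormal_basis_def subset_iff)
  moreover have "finite L'" using assms finite_subset by blast
  ultimately show ?thesis using assms(4) by (simp add: cip_sum_right)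
qed

lemma orthonormal_basis_expand:
  assumes "orthonormal_basis I V L f" "finite L" "v \<in> V"
  shows "v = (\<lambda>i. \<Sum>x\<in>L. cip I (f x) v * f x i)"
proof -
  obtain c where c: "v = (\<lambda>i. \<Sum>x\<in>L. c x * f x i)"
    using assms(1,3) by (auto simp: orthonormal_basis_def cspan_def)
  have "cip I (f x) v = c x" if "x \<in> L" for x
    unfolding c by (rule cip_orthonormal_sum[OF assms(1,2) subset_refl that])
  then show ?thesis using c by simp
qed

lemma top_in_idx [simp]: "(p, 0, 0) \<in> idx p"
  by (simp add: idx_def)

text \<open>The projector has a single nonzero entry. By \<open>berezin_x0\<close> the same entry of
  A is its symbol at \<open>x0\<close>, so overlaps with the kernel are conjugated symbol values
  there.\<close>

lemma cip_projector: "cip (idx p \<times> idx p) A (projector p e1) = cnj (A ((p, 0, 0), (p, 0, 0)))"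
proof -
  have "cip (idx p \<times> idx p) A (projector p e1)
      = (\<Sum>i\<in>idx p \<times> idx p. if i = ((p, 0, 0), (p, 0, 0)) then cnj (A ((p, 0, 0), (p, 0, 0))) else 0)"
    unfolding cip_def projector_e1 by (intro sum.cong refl) (auto split: if_splits)
  then show ?thesis by simp
qed

lemma berezin_x0: "berezin p A x0 = A ((p, 0, 0), (p, 0, 0))"
proof -
  have "berezin p A x0 = qform p A e1" by (simp add: x0_def berezin_unit)
  also have "\<dots> = (\<Sum>a\<in>idx p. if a = (p, 0, 0) then A ((p, 0, 0), (p, 0, 0)) else 0)"
    unfolding qform_def cip_def using mv_top[of p A 1 "(p, 0, 0)"]
    by (intro sum.cong refl) (simp add: Phi_e1[abs_def])
  finally show ?thesis by simp
qed

text \<open>Meant for \<open>Emat 3 2\<close>: commutators with it are orthogonal to the kernel, by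
  \<open>cip_projector\<close>. The next lemma is the companion fact that it commutes with the
  kernel.\<close>

lemma op_comm_top:
  assumes "\<And>i. X $ i $ 1 = 0" "\<And>j. X $ 1 $ j = 0"
  shows "op_comm p X A ((p, 0, 0), (p, 0, 0)) = 0"
  by (simp add: op_comm_def mm_def dsym_top_col[OF assms(1)] dsym_top_row[OF assms(2)])

lemma op_comm_projector:
  assumes "\<And>i. X $ i $ 1 = 0" "\<And>j. X $ 1 $ j = 0"
  shows "op_comm p X (projector p e1) i = 0"
proof -
  obtain a b where i: "i = (a, b)" by (cases i)
  have "dsym p X (a, c) * projector p e1 (c, b) = 0" "projector p e1 (a, c) * dsym p X (c, b) = 0" for c
    using dsym_top_col[OF assms(1), of p a] dsym_top_row[OF assms(2), of p b]
    by (auto simp: projector_e1)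
  note zero = this
  have "mm (idx p) (dsym p X) (projector p e1) i = 0" "mm (idx p) (projector p e1) (dsym p X) i = 0"
    unfolding mm_def i prod.case by (simp_all only: zero sum.neutral_const)
  then show ?thesis by (simp add: op_comm_def)
qed

lemma mm_sum_right: "mm I A (\<lambda>i. \<Sum>x\<in>L. c x * f x i) i = (\<Sum>x\<in>L. c x * mm I A (f x) i)"
proof (cases i)
  case (Pair a b)
  have "mm I A (\<lambda>i. \<Sum>x\<in>L. c x * f x i) i = (\<Sum>d\<in>I. \<Sum>x\<in>L. c x * (A (a, d) * f x (d, b)))"
    by (simp add: mm_def Pair sum_distrib_left mult_ac)
  also have "\<dots> = (\<Sum>x\<in>L. \<Sum>d\<in>I. c x * (A (a, d) * f x (d, b)))" by (rule sum.swap)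
  finally show ?thesis by (simp add: mm_def Pair sum_distrib_left)
qed

lemma mm_sum_left: "mm I (\<lambda>i. \<Sum>x\<in>L. c x * f x i) A i = (\<Sum>x\<in>L. c x * mm I (f x) A i)"
proof (cases i)
  case (Pair a b)
  have "mm I (\<lambda>i. \<Sum>x\<in>L. c x * f x i) A i = (\<Sum>d\<in>I. \<Sum>x\<in>L. c x * (f x (a, d) * A (d, b)))"
    by (simp add: mm_def Pair sum_distrib_right mult.assoc)
  also have "\<dots> = (\<Sum>x\<in>L. \<Sum>d\<in>I. c x * (f x (a, d) * A (d, b)))" by (rule sum.swap)
  finally show ?thesis by (simp add: mm_def Pair sum_distrib_left)
qed

lemma op_comm_sum: "op_comm p X (\<lambda>i. \<Sum>x\<in>L. c x * f x i) i = (\<Sum>x\<in>L. c x * op_comm p X (f x) i)"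
  by (simp add: op_comm_def mm_sum_left mm_sum_right sum_subtractf right_diff_distrib)

definition coupled_labels :: "nat \<Rightarrow> (nat \<times> weight \<times> real) set" where
  "coupled_labels p = {(n, l). n \<le> p \<and> l \<in> gt_labels n n}"

text \<open>The label shift of \<open>U_minus\<close>, defined on all triples so that it is
  injective outright. It may leave \<open>coupled_labels\<close>, but by \<open>lower_mem\<close>
  only where the coefficient of \<open>U_minus\<close> is zero.\<close>

definition lower :: "nat \<times> weight \<times> real \<Rightarrow> nat \<times> weight \<times> real" where
  "lower = (\<lambda>(n, (\<nu>1, \<nu>2, \<nu>3), J). (n, (\<nu>1, \<nu>2 - 1, \<nu>3 + 1), J))"

lemma inj_lower: "inj lower"
  by (auto simp: inj_def lower_def)

lemma finite_coupled_labels: "finite (coupled_labels p)"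
proof -
  have "coupled_labels p = (SIGMA n:{..p}. gt_labels n n)" by (auto simp: coupled_labels_def)
  then show ?thesis by (simp add: finite_gt_labels)
qed

lemma lower_mem:
  assumes "(n, \<nu>, J) \<in> coupled_labels p" "gt_U_coeff \<nu> J \<noteq> 0"
  shows "lower (n, \<nu>, J) \<in> coupled_labels p"
proof -
  obtain rm rp \<nu>3 where l: "\<nu> = (int n + 2 * int n - (rp + rm), rp + rm - \<nu>3, \<nu>3)" "J = real_of_int (rp - rm) / 2"
    "0 \<le> rm" "rm \<le> int n" "int n \<le> rp" "rp \<le> int n + int n" "rm \<le> \<nu>3" "\<nu>3 \<le> rp"
    using assms(1) by (auto simp: coupled_labels_def gt_labels_def)
  have "\<nu>3 \<noteq> rp" using assms(2) unfolding l(1,2) gt_U_coeff_label by auto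
  then have "((int n + 2 * int n - (rp + rm), rp + rm - (\<nu>3 + 1), \<nu>3 + 1), real_of_int (rp - rm) / 2) \<in> gt_labels n n"
    using l by (intro gt_labelsI) auto
  then show ?thesis
    using assms(1) by (simp add: coupled_labels_def lower_def l(1,2) diff_diff_eq)
qed

text \<open>A label that is neither lowerable nor a lowering has \<open>J = 0\<close>, and \<open>r\<^sub>- \<le> n \<le> r\<^sub>+\<close> leaves
  only \<open>r\<^sub>- = r\<^sub>+ = n\<close>.\<close>

lemma coupled_label_cases:
  assumes "(n, \<nu>, J) \<in> coupled_labels p"
  obtains "gt_U_coeff \<nu> J \<noteq> 0"
  | \<nu>' where "(n, \<nu>', J) \<in> coupled_labels p" "gt_U_coeff \<nu>' J \<noteq> 0" "lower (n, \<nu>', J) = (n, \<nu>, J)"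
  | "\<nu> = (int n, int n, int n)" "J = 0"
proof -
  obtain rm rp \<nu>3 where l: "\<nu> = (int n + 2 * int n - (rp + rm), rp + rm - \<nu>3, \<nu>3)" "J = real_of_int (rp - rm) / 2"
    "0 \<le> rm" "rm \<le> int n" "int n \<le> rp" "rp \<le> int n + int n" "rm \<le> \<nu>3" "\<nu>3 \<le> rp"
    using assms by (auto simp: coupled_labels_def gt_labels_def)
  have np: "n \<le> p" using assms by (simp add: coupled_labels_def)
  consider "\<nu>3 < rp" | "\<nu>3 = rp" "rm < rp" | "\<nu>3 = rp" "rm = rp" using l by linarith
  then show ?thesis
  proof cases
    case 1
    then have "gt_U_coeff \<nu> J \<noteq> 0" unfolding l(1,2) gt_U_coeff_label using l by simp
    then show ?thesis by (rule that(1))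
  next
    case 2
    define \<nu>' where "\<nu>' = (int n + 2 * int n - (rp + rm), rp + rm - (\<nu>3 - 1), \<nu>3 - 1)"
    have "(\<nu>', J) \<in> gt_labels n n"
      unfolding \<nu>'_def l(2) by (rule gt_labelsI) (use l 2 in auto)
    then have "(n, \<nu>', J) \<in> coupled_labels p"
      using np by (simp add: coupled_labels_def)
    moreover have "gt_U_coeff \<nu>' J \<noteq> 0"
      unfolding \<nu>'_def l(2) gt_U_coeff_label using 2 by simp
    moreover have "lower (n, \<nu>', J) = (n, \<nu>, J)" by (simp add: lower_def \<nu>'_def l(1))
    ultimately show ?thesis by (rule that(2))
  next
    case 3
    then have "rm = int n" "rp = int n" "\<nu>3 = int n" using l by auto
    then show ?thesis using l(1,2) by (intro that(3)) auto
  qed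
qed

lemma sign_cancel: "(-1) ^ p * ((-1) ^ p * x) = (x :: complex)"
  by (simp flip: mult.assoc power_mult_distrib)

section \<open>Coefficients of the kernel\<close>

locale coupled =
  fixes p :: nat and e :: "weight \<Rightarrow> midx cvec"
    and E :: "nat \<Rightarrow> weight \<Rightarrow> real \<Rightarrow> (midx \<times> midx) cvec"
  assumes coupled: "coupled_basis p e E"
begin

abbreviation F :: "nat \<times> weight \<times> real \<Rightarrow> (midx \<times> midx) cvec" where
  "F \<equiv> \<lambda>(n, \<nu>, J). E n \<nu> J"

lemma basis: "orthonormal_basis (idx p \<times> idx p) (ops p) (coupled_labels p) F"
  using coupled by (simp add: coupled_basis_def coupled_labels_def)

lemma gt: "n \<le> p \<Longrightarrow> gt_basis (op_rep p) (idx p \<times> idx p)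
    (cspan (gt_labels n n) (\<lambda>(\<nu>, J). E n \<nu> J)) n n (E n)"
  using coupled by (simp add: coupled_basis_def)

lemma F_in_ops: "x \<in> coupled_labels p \<Longrightarrow> F x \<in> ops p"
  by (rule orthonormal_basis_mem[OF basis finite_coupled_labels])

lemma op_comm_E:
  assumes "(n, \<nu>, J) \<in> coupled_labels p"
  shows "op_comm p (Emat 3 2) (E n \<nu> J) = (\<lambda>i. of_real (gt_U_coeff \<nu> J) * F (lower (n, \<nu>, J)) i)"
proof -
  obtain \<nu>1 \<nu>2 \<nu>3 where \<nu>: "\<nu> = (\<nu>1, \<nu>2, \<nu>3)" by (cases \<nu>)
  have "U_minus (op_rep p) (E n \<nu> J) = (\<lambda>i. of_real (gt_U_coeff \<nu> J) * F (lower (n, \<nu>, J)) i)"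
    using gt[of n] assms by (simp add: coupled_labels_def gt_basis_def \<nu> lower_def)
  then show ?thesis using lie_op_rep[OF F_in_ops[OF assms]] by (simp add: U_minus_def)
qed

definition kcoeff :: "nat \<times> weight \<times> real \<Rightarrow> complex" where
  "kcoeff x = cip (idx p \<times> idx p) (F x) (projector p e1)"

lemma projector_expand: "projector p e1 = (\<lambda>i. \<Sum>x\<in>coupled_labels p. kcoeff x * F x i)"
  unfolding kcoeff_def
  by (rule orthonormal_basis_expand[OF basis finite_coupled_labels projector_in_ops])

text \<open>Up to a nonzero factor the basis operator at a lowered label is a commutator with
  \<open>Emat 3 2\<close>, so its top entry is 0.\<close>

lemma kcoeff_lower:
  assumes "(n, \<nu>, J) \<in> coupled_labels p" "gt_U_coeff \<nu> J \<noteq> 0"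
  shows "kcoeff (lower (n, \<nu>, J)) = 0"
proof -
  have "op_comm p (Emat 3 2) (E n \<nu> J) ((p, 0, 0), (p, 0, 0)) = 0"
    by (rule op_comm_top) (simp_all add: Emat_def)
  then show ?thesis
    using assms(2) unfolding op_comm_E[OF assms(1)] by (simp add: kcoeff_def cip_projector)
qed

text \<open>Commuting \<open>Emat 3 2\<close> with the expansion of the kernel gives 0, a linear
  relation among basis operators at lowered labels. These are distinct, so each product of kernel
  coefficient and \<open>U_minus\<close> coefficient is 0.\<close>

lemma kcoeff_lowerable:
  assumes "(n, \<nu>, J) \<in> coupled_labels p" "gt_U_coeff \<nu> J \<noteq> 0"
  shows "kcoeff (n, \<nu>, J) = 0"
proof -
  define u :: "nat \<times> weight \<times> real \<Rightarrow> complex" where "u = (\<lambda>(n, \<nu>, J). of_real (gt_U_coeff \<nu> J))"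
  \<comment> \<open>Labels with zero coefficient are dropped because their lowering need not be a
    label.\<close>
  define L where "L = {x \<in> coupled_labels p. u x \<noteq> 0}"
  have y: "(n, \<nu>, J) \<in> L" using assms by (simp add: L_def u_def)
  have sub: "lower ` L \<subseteq> coupled_labels p"
    using lower_mem by (auto simp: L_def u_def)
  have comm: "op_comm p (Emat 3 2) (F x) i = u x * F (lower x) i" if "x \<in> coupled_labels p" for x i
    using op_comm_E that by (cases x) (simp add: u_def)
  have "0 = (\<Sum>x\<in>coupled_labels p. kcoeff x * op_comm p (Emat 3 2) (F x) i)" for i
    unfolding op_comm_sum[symmetric] projector_expand[symmetric]
    by (rule op_comm_projector[symmetric]) (simp_all add: Emat_def)
  also have "(\<Sum>x\<in>coupled_labels p. kcoeff x * op_comm p (Emat 3 2) (F x) i)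
      = (\<Sum>x\<in>L. kcoeff x * (u x * F (lower x) i))" for i
    using finite_coupled_labels by (intro sum.mono_neutral_cong_right) (auto simp: L_def comm)
  \<comment> \<open>Reindexing along the injective \<open>lower\<close> makes this a combination
    over a subset of the orthonormal basis, from which coefficients can be read off.\<close>
  also have "(\<Sum>x\<in>L. kcoeff x * (u x * F (lower x) i))
      = (\<Sum>x\<in>lower ` L. kcoeff (inv lower x) * u (inv lower x) * F x i)" for i
    by (subst sum.reindex) (auto simp: inv_f_f[OF inj_lower] mult.assoc intro: inj_on_subset[OF inj_lower])
  finally have "cip (idx p \<times> idx p) (F (lower (n, \<nu>, J)))
      (\<lambda>i. \<Sum>x\<in>lower ` L. kcoeff (inv lower x) * u (inv lower x) * F x i) = 0"
    by (simp add: cip_def)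
  then have "kcoeff (inv lower (lower (n, \<nu>, J))) * u (inv lower (lower (n, \<nu>, J))) = 0"
    using cip_orthonormal_sum[OF basis finite_coupled_labels sub imageI[OF y],
        where c = "\<lambda>x. kcoeff (inv lower x) * u (inv lower x)"] by simp
  then show ?thesis using assms(2) by (simp add: inv_f_f[OF inj_lower] u_def)
qed

lemma kcoeff_zero:
  assumes "(n, \<nu>, J) \<in> coupled_labels p" "(\<nu>, J) \<noteq> ((int n, int n, int n), 0)"
  shows "kcoeff (n, \<nu>, J) = 0"
  using assms(1)
proof (cases rule: coupled_label_cases)
  case 1
  then show ?thesis using kcoeff_lowerable assms by simp
next
  case (2 \<nu>')
  then show ?thesis using kcoeff_lower[of n \<nu>' J] by simp
qed (use assms in simp)

definition mid :: "nat \<Rightarrow> nat \<times> weight \<times> real" where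
  "mid n = (n, (int n, int n, int n), 0)"

lemma mid_mem: "n \<le> p \<Longrightarrow> mid n \<in> coupled_labels p"
  by (simp add: mid_def coupled_labels_def gt_labels_middle)

lemma projector_expand_mid: "projector p e1 = (\<lambda>i. \<Sum>n\<le>p. kcoeff (mid n) * F (mid n) i)"
proof
  fix i
  have "projector p e1 i = (\<Sum>x\<in>coupled_labels p. kcoeff x * F x i)"
    by (subst projector_expand) (rule refl)
  also have "\<dots> = (\<Sum>x\<in>mid ` {..p}. kcoeff x * F x i)"
  proof (rule sum.mono_neutral_right[OF finite_coupled_labels])
    show "mid ` {..p} \<subseteq> coupled_labels p" using mid_mem by auto
    show "\<forall>x\<in>coupled_labels p - mid ` {..p}. kcoeff x * F x i = 0"
    proof
      fix x assume x: "x \<in> coupled_labels p - mid ` {..p}"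
      obtain n \<nu> J where x': "x = (n, \<nu>, J)" by (cases x)
      then have "n \<le> p" using x by (simp add: coupled_labels_def)
      then have "(\<nu>, J) \<noteq> ((int n, int n, int n), 0)" using x by (auto simp: x' mid_def image_iff)
      then show "kcoeff x * F x i = 0" using kcoeff_zero x by (simp add: x')
    qed
  qed
  also have "\<dots> = (\<Sum>n\<le>p. kcoeff (mid n) * F (mid n) i)"
    by (subst sum.reindex) (auto simp: inj_on_def mid_def)
  finally show "projector p e1 i = (\<Sum>n\<le>p. kcoeff (mid n) * F (mid n) i)" .
qed

lemma cip_mid:
  assumes "m \<le> p"
  shows "cip (idx p \<times> idx p) (F (mid m)) (\<lambda>i. \<Sum>n\<le>p. c n * F (mid n) i) = c m"
proof -
  have "(\<Sum>n\<le>p. c n * F (mid n) i) = (\<Sum>x\<in>mid ` {..p}. c (fst x) * F x i)" for i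
    by (subst sum.reindex) (auto simp: inj_on_def mid_def)
  moreover have "cip (idx p \<times> idx p) (F (mid m)) (\<lambda>i. \<Sum>x\<in>mid ` {..p}. c (fst x) * F x i) = c (fst (mid m))"
    by (rule cip_orthonormal_sum[OF basis finite_coupled_labels]) (use assms mid_mem in auto)
  ultimately show ?thesis by (simp add: mid_def)
qed

text \<open>If the component of the kernel in the summand \<open>(n,n)\<close> vanished, so would the symbol of every
  operator in that summand.\<close>

lemma kcoeff_mid_nonzero:
  assumes "n \<le> p"
  shows "kcoeff (mid n) \<noteq> 0"
proof
  assume 0: "kcoeff (mid n) = 0"
  define V where "V = cspan (gt_labels n n) (\<lambda>(\<nu>, J). E n \<nu> J)"
  have E: "E n \<nu> J ((p, 0, 0), (p, 0, 0)) = 0" if "(\<nu>, J) \<in> gt_labels n n" for \<nu> J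
  proof -
    have "(n, \<nu>, J) \<in> coupled_labels p" using that assms by (simp add: coupled_labels_def)
    then have "kcoeff (n, \<nu>, J) = 0"
      using kcoeff_zero 0 by (cases "(\<nu>, J) = ((int n, int n, int n), 0)") (auto simp: mid_def)
    then show ?thesis by (simp add: kcoeff_def cip_projector)
  qed
  have V: "v ((p, 0, 0), (p, 0, 0)) = 0" if "v \<in> V" for v
    using that E by (auto simp: V_def cspan_def split_beta intro!: sum.neutral)
  define E0 where "E0 = F (mid n)"
  have "gt_basis (op_rep p) (idx p \<times> idx p) V n n (E n)"
    unfolding V_def by (rule gt[OF assms])
  then have inv: "\<And>g v. g \<in> SU3 \<Longrightarrow> v \<in> V \<Longrightarrow> op_rep p g v \<in> V"
    and onb: "orthonormal_basis (idx p \<times> idx p) V (gt_labels n n) (\<lambda>(\<nu>, J). E n \<nu> J)"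
    by (auto simp: gt_basis_def)
  have "E0 \<in> V"
    using orthonormal_basis_mem[OF onb finite_gt_labels gt_labels_middle] by (simp add: E0_def mid_def)
  have "berezin p E0 x = 0" for x
  proof -
    obtain g where g: "g \<in> SU3" "x = act g x0" using CP2_orbit by blast
    have h: "cadj g \<in> SU3" "matrix_inv (cadj g) = g"
      using SU3_D(5)[OF g(1)] SU3_D(4)[of "cadj g"] by auto
    \<comment> \<open>Equivariance moves the evaluation to \<open>x0\<close>, where the symbol is
      the top entry, and the moved operator stays in the invariant space \<open>V\<close>.\<close>
    have "berezin p E0 x = berezin p (op_rep p (cadj g) E0) x0"
      by (simp add: berezin_op_rep[OF h(1)] h(2) g(2))
    also have "\<dots> = 0" unfolding berezin_x0 by (rule V[OF inv[OF h(1) \<open>E0 \<in> V\<close>]])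
    finally show ?thesis .
  qed
  moreover have "berezin p (\<lambda>_. 0) x = 0" for x
    by (simp add: berezin_expand[of p "\<lambda>_. 0"])
  ultimately have "berezin p E0 = berezin p (\<lambda>_. 0)" by auto
  moreover have "E0 \<in> ops p" unfolding E0_def by (rule F_in_ops[OF mid_mem[OF assms]])
  moreover have "(\<lambda>_. 0) \<in> ops p" by (simp add: cspace_def)
  ultimately have "E0 = (\<lambda>_. 0)" using inj_on_berezin by (metis inj_onD)
  moreover have "cip (idx p \<times> idx p) E0 E0 = 1"
    using basis mid_mem[OF assms] by (simp add: E0_def orthonormal_basis_def)
  ultimately show False by (simp add: cip_def)
qed

lemma kcoeff_mid_0: "kcoeff (mid 0) = of_real (1 / sqrt (irrep_dim p 0))"
proof -
  have "E 0 (0, 0, 0) 0 = (\<lambda>i. op_id (idx p) i / of_real (sqrt (irrep_dim p 0)))"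
    using coupled by (simp add: coupled_basis_def)
  then show ?thesis by (simp add: kcoeff_def mid_def cip_projector op_id_def)
qed

text \<open>The highest weight vector is a unit multiple of \<open>Phi p e1\<close>, and its phase
  meets its own conjugate in the dual vector. The sign is \<open>(-1) powi (\<nu>1 - \<nu>3)\<close>
  at the weight (p,0,0).\<close>

lemma tensor_highest_weight:
  assumes "gt_basis (vec_rep p) (idx p) (cspace (idx p)) p 0 (\<lambda>\<nu> J. e \<nu>)"
  shows "tensor (e (int p, 0, 0)) (dual_gt p e (0, int p, int p)) = (\<lambda>i. (-1) ^ p * projector p e1 i)"
proof -
  have "e (int p, 0, 0) \<in> highest_weight_space (vec_rep p) (cspace (idx p)) p 0"
    using assms by (simp add: gt_basis_def)
  then obtain c where c: "e (int p, 0, 0) = (\<lambda>i. c * Phi p e1 i)"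
    unfolding highest_weight_space_vec_rep by blast
  have "((int p, 0, 0), 0) \<in> gt_labels p 0" using gt_labelsI[of 0 0 0 p 0] by simp
  moreover have "\<forall>x\<in>gt_labels p 0. \<forall>y\<in>gt_labels p 0.
      cip (idx p) ((\<lambda>(\<nu>, J). e \<nu>) x) ((\<lambda>(\<nu>, J). e \<nu>) y) = (if x = y then 1 else 0)"
    using assms unfolding gt_basis_def orthonormal_basis_def by (elim conjE)
  ultimately have "cip (idx p) (e (int p, 0, 0)) (e (int p, 0, 0)) = 1"
    by (auto dest!: bspec)
  moreover have "cip (idx p) (e (int p, 0, 0)) (e (int p, 0, 0)) = c * cnj c * cip (idx p) (Phi p e1) (Phi p e1)"
    by (simp add: c cip_def sum_distrib_left mult_ac)
  ultimately have "c * cnj c = 1" by (simp add: Phi_norm)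
  then have "c * x * (s * (cnj c * y)) = s * (x * y)" for x y s
    by (metis mult.assoc mult.left_commute mult_1)
  then show ?thesis
    by (auto simp: fun_eq_iff tensor_def dual_gt_def dual_vec_def projector_def c)
qed

lemma clebsch_gordan_top:
  assumes "gt_basis (vec_rep p) (idx p) (cspace (idx p)) p 0 (\<lambda>\<nu> J. e \<nu>)"
  shows "clebsch_gordan p e E (int p, 0, 0) (0, int p, int p) n (int n, int n, int n) 0
    = (-1) ^ p * kcoeff (mid n)"
  unfolding clebsch_gordan_def tensor_highest_weight[OF assms]
  by (simp add: kcoeff_def mid_def cip_def sum_distrib_left mult_ac)

lemma kcoeff_mid_real:
  assumes "gt_basis (vec_rep p) (idx p) (cspace (idx p)) p 0 (\<lambda>\<nu> J. e \<nu>)" and n: "n \<le> p"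
  shows "kcoeff (mid n) \<in> \<real>"
proof -
  have "((int p, 0, 0), 0) \<in> gt_labels p 0" using gt_labelsI[of 0 0 0 p 0] by simp
  then have 1: "(int p, 0, 0) \<in> fst ` gt_labels p 0" by force
  have "((0, int p, int p), 0) \<in> gt_labels 0 p" using gt_labelsI[of "int p" p "int p" 0 "int p"] by simp
  then have 2: "(0, int p, int p) \<in> fst ` gt_labels 0 p" by force
  have "clebsch_gordan p e E (int p, 0, 0) (0, int p, int p) n (int n, int n, int n) 0 \<in> \<real>"
    using coupled n gt_labels_middle[of n] 1 2 unfolding coupled_basis_def by blast
  then have "(-1) ^ p * ((-1) ^ p * kcoeff (mid n)) \<in> \<real>"
    unfolding clebsch_gordan_top[OF assms(1)] by (rule Reals_mult[rotated]) simp
  then show ?thesis by (simp only: sign_cancel)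
qed

text \<open>Since the kernel is unique, any such expansion is an expansion of the projector, and
  orthonormality compares the coefficients. Conversely, these values satisfy the side conditions by
  the preceding lemmas on \<open>kcoeff (mid n)\<close>.\<close>

lemma characteristic_numbers_iff:
  assumes e: "gt_basis (vec_rep p) (idx p) (cspace (idx p)) p 0 (\<lambda>\<nu> J. e \<nu>)"
  shows "characteristic_numbers p E (berezin p) b \<longleftrightarrow>
    (\<forall>n\<le>p. b n = of_real (sqrt (irrep_dim p 0 / (real n + 1) ^ 3)) * kcoeff (mid n))"
proof -
  \<comment> \<open>\<open>s\<close> is the normalisation in the definition of characteristic
    numbers and \<open>r\<close> its reciprocal.\<close>
  define r s where "r n = sqrt (irrep_dim p 0 / (real n + 1) ^ 3)"
    and "s n = sqrt ((real n + 1) ^ 3 / irrep_dim p 0)" for n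
  have rs: "r n * s n = 1" and r: "r n \<noteq> 0" for n
    using irrep_dim_pos[of p] by (simp_all add: r_def s_def flip: real_sqrt_mult)
  have rs': "complex_of_real (r n) * of_real (s n) = 1" for n
    by (simp add: rs flip: of_real_mult)
  have mid: "E n (int n, int n, int n) 0 i = F (mid n) i" for n i by (simp add: mid_def)
  show ?thesis
    unfolding r_def[symmetric]
  proof
    assume b: "characteristic_numbers p E (berezin p) b"
    then have "operator_kernel p (berezin p) (\<lambda>i. \<Sum>n\<le>p. b n * of_real (s n) * F (mid n) i)"
      by (simp add: characteristic_numbers_def s_def mid)
    then have "projector p e1 = (\<lambda>i. \<Sum>n\<le>p. b n * of_real (s n) * F (mid n) i)"
      by (rule operator_kernel_unique[OF operator_kernel_projector])
    then have "kcoeff (mid n) = b n * of_real (s n)" if "n \<le> p" for n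
      using cip_mid[OF that, of "\<lambda>n. b n * of_real (s n)"] by (simp add: kcoeff_def)
    then show "\<forall>n\<le>p. b n = of_real (r n) * kcoeff (mid n)"
      using rs' by (simp add: mult.left_commute)
  next
    assume b: "\<forall>n\<le>p. b n = of_real (r n) * kcoeff (mid n)"
    have "(\<lambda>i. \<Sum>n\<le>p. b n * of_real (s n) * F (mid n) i) = projector p e1"
      unfolding projector_expand_mid
    proof (intro ext sum.cong refl)
      fix i n assume "n \<in> {..p}"
      then have "b n * of_real (s n) = (of_real (r n) * of_real (s n)) * kcoeff (mid n)"
        using b by (simp add: mult_ac)
      then show "b n * of_real (s n) * F (mid n) i = kcoeff (mid n) * F (mid n) i"
        by (simp add: rs')
    qed
    then have "operator_kernel p (berezin p) (\<lambda>i. \<Sum>n\<le>p. b n * of_real (s n) * F (mid n) i)"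
      by (simp add: operator_kernel_projector)
    moreover have "b 0 = 1"
      using b irrep_dim_pos[of p] by (simp add: kcoeff_mid_0 r_def flip: of_real_mult)
    moreover have "b n \<in> \<real> \<and> b n \<noteq> 0" if "n \<le> p" for n
      using b that r kcoeff_mid_nonzero kcoeff_mid_real[OF e] by simp
    ultimately show "characteristic_numbers p E (berezin p) b"
      by (simp add: characteristic_numbers_def s_def mid)
  qed
qed

end

theorem proposition4p17:
  fixes p :: nat
    and \<mu> :: "CP2 measure"
    and e :: "weight \<Rightarrow> midx cvec"
    and E :: "nat \<Rightarrow> weight \<Rightarrow> real \<Rightarrow> (midx \<times> midx) cvec"
  assumes "p \<ge> 1"
    and "invariant_prob \<mu>"
    and "gt_basis (vec_rep p) (idx p) (cspace (idx p)) p 0 (\<lambda>\<nu> J. e \<nu>)"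
    and "coupled_basis p e E"
  shows "(\<forall>A\<in>ops p. \<forall>n x. norm n = 1 \<and> proj n = x \<longrightarrow>
            berezin p A x = cip (idx p) (Phi p n) (mv (idx p) A (Phi p n)))
       \<and> symbol_correspondence \<mu> p (berezin p)
       \<and> mapping_positive p (berezin p)
       \<and> (\<forall>K. operator_kernel p (berezin p) K \<longleftrightarrow>
            K = orth_projection (idx p) (highest_weight_space (vec_rep p) (cspace (idx p)) p 0))
       \<and> (\<forall>b. characteristic_numbers p E (berezin p) b \<longleftrightarrow>
            (\<forall>n\<le>p. b n = (-1) ^ p * of_real (sqrt (irrep_dim p 0 / (real n + 1) ^ 3))
               * clebsch_gordan p e E (int p, 0, 0) (0, int p, int p) n (int n, int n, int n) 0))"
proof (intro conjI)
  interpret coupled p e E using assms(4) by unfold_locales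
  show "\<forall>A\<in>ops p. \<forall>n x. norm n = 1 \<and> proj n = x \<longrightarrow>
      berezin p A x = cip (idx p) (Phi p n) (mv (idx p) A (Phi p n))"
    by (auto simp: berezin_unit qform_def)
  show "symbol_correspondence \<mu> p (berezin p)"
    by (rule symbol_correspondence_berezin[OF assms(2)])
  show "mapping_positive p (berezin p)"
    by (rule mapping_positive_berezin)
  show "\<forall>K. operator_kernel p (berezin p) K \<longleftrightarrow>
      K = orth_projection (idx p) (highest_weight_space (vec_rep p) (cspace (idx p)) p 0)"
    unfolding projector_eq_orth_projection[symmetric]
    using operator_kernel_projector operator_kernel_unique by blast
  \<comment> \<open>One sign stands in the formula for b_n, the other comes from the dual basis
    inside the Clebsch-Gordan coefficient.\<close>
  have sign: "(-1) ^ p * x * ((-1) ^ p * y) = x * y" for x y :: complex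
    by (simp add: mult.left_commute[of x] mult.assoc sign_cancel)
  show "\<forall>b. characteristic_numbers p E (berezin p) b \<longleftrightarrow>
      (\<forall>n\<le>p. b n = (-1) ^ p * of_real (sqrt (irrep_dim p 0 / (real n + 1) ^ 3))
         * clebsch_gordan p e E (int p, 0, 0) (0, int p, int p) n (int n, int n, int n) 0)"
    unfolding clebsch_gordan_top[OF assms(3)] characteristic_numbers_iff[OF assms(3)] sign by simp
qed

end
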